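(* For every $\kappa^2>0$, \[ \int_{-\pi}^{\pi}|\partial_t\mathbf{u}|^2\,dt+\kappa^2\int_{-\pi}^{\pi}|\mathbf{u}\times\mathbf{n}|^2\,dt\ \ge\ c_\kappa^2\int_{-\pi}^{\pi}|\mathbf{u}|^2\,dt\qquad\forall\,\mathbf{u}\in H^1_\sharp([-\pi,\pi],\mathbb{R}^3), \] where the best constant is \[ c_\kappa^2=\begin{cases}1 & \text{if }\kappa^2\ge3,\\ \tfrac12(\kappa^2-\omega_\kappa^2+4) & \text{if }0<\kappa^2\le3,\end{cases}\qquad \omega_\kappa^2=\sqrt{\kappa^4+16}. \] Moreover, among $\mathbf{u}\in H^1_\sharp([-\pi,\pi],\mathbb{R}^3)$ normalized by $\frac{1}{2\pi}\int_{-\pi}^{\pi}|\mathbf{u}|^2\,dt=1$, equality holds if and only if $\mathbf{u}$ has third component identically zero and: (i) if $\kappa^2>3$: $\mathbf{u}=\pm\mathbf{n}$; (ii) if $\kappa^2=3$: $\mathbf{u}(t)=\sqrt2\rho_1\cos(\theta+t)\boldsymbol{\tau}(t)+\big[\pm\sqrt{1-5\rho_1^2}+2\sqrt2\rho_1\sin(\theta+t)\big]\mathbf{n}(t)$ for some $\theta\in[-\pi,\pi]$, $0\le\rho_1\le1/\sqrt5$ and some choice of sign (in particular $\pm\mathbf{n}$ are equality cases, corresponding to $\rho_1=0$); (iii) if $0<\kappa^2<3$: $\mathbf{u}(t)=\sqrt2(\sin\phi_\kappa)\cos(\theta+t)\boldsymbol{\tau}(t)+\sqrt2(\cos\phi_\kappa)\sin(\theta+t)\mathbf{n}(t)$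 for some $\theta\in[-\pi,\pi]$, where $\phi_\kappa=\frac12\arctan(4/\kappa^2)\in[0,\pi/2]$. In particular, for $0<\kappa^2<3$ there is no $\mathbf{u}$ with $|\mathbf{u}|=1$ a.e. attaining equality.
   Context: $H^1_\sharp([-\pi,\pi],\mathbb{R}^3)$ denotes the Sobolev space of $2\pi$-periodic $H^1$ functions $[-\pi,\pi]\to\mathbb{R}^3$ (identified with $H^1(\mathbb{S}^1,\mathbb{R}^3)$ via the parameterization $t\mapsto(\cos t,\sin t)$ of the unit circle). $\mathbf{n}(t)=(\cos t,\sin t,0)$ and $\boldsymbol{\tau}(t)=\partial_t\mathbf{n}(t)=(-\sin t,\cos t,0)$. *)

theory Defs
  imports "HOL-Analysis.Analysis" "HOL-Analysis.Cross3"
begin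

definition nvec :: "real \<Rightarrow> real^3" where
  "nvec t = vector [cos t, sin t, 0]"

definition tauvec :: "real \<Rightarrow> real^3" where
  "tauvec t = vector [- sin t, cos t, 0]"

text \<open>H1_per u g: u is (the continuous representative of) an element of the periodic
  Sobolev space H^1 on [-pi,pi] with values in R^3, and g is its weak derivative:
  g is square integrable (hence integrable on the bounded interval),
  u is the indefinite integral of g, and u(-pi) = u(pi).\<close>
definition H1_per :: "(real \<Rightarrow> real^3) \<Rightarrow> (real \<Rightarrow> real^3) \<Rightarrow> bool" where
  "H1_per u g \<longleftrightarrow>
     g absolutely_integrable_on {-pi..pi} \<and>
     (\<lambda>t. (norm (g t))\<^sup>2) integrable_on {-pi..pi} \<and>
     (\<forall>t\<in>{-pi..pi}. u t = u (-pi) + integral {-pi..t} g) \<and>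
     u pi = u (-pi)"

text \<open>omega_kappa^2 and c_kappa^2, parametrised by k2 = kappa^2.\<close>
definition omega2 :: "real \<Rightarrow> real" where
  "omega2 k2 = sqrt (k2\<^sup>2 + 16)"

definition c2 :: "real \<Rightarrow> real" where
  "c2 k2 = (if k2 \<ge> 3 then 1 else (k2 - omega2 k2 + 4) / 2)"

definition phik :: "real \<Rightarrow> real" where
  "phik k2 = arctan (4 / k2) / 2"

definition energy :: "real \<Rightarrow> (real \<Rightarrow> real^3) \<Rightarrow> (real \<Rightarrow> real^3) \<Rightarrow> real" where
  "energy k2 u g = integral {-pi..pi} (\<lambda>t. (norm (g t))\<^sup>2)
                   + k2 * integral {-pi..pi} (\<lambda>t. (norm (cross3 (u t) (nvec t)))\<^sup>2)"

definition L2sq :: "(real \<Rightarrow> real^3) \<Rightarrow> real" where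
  "L2sq u = integral {-pi..pi} (\<lambda>t. (norm (u t))\<^sup>2)"

end

(*
In the moving frame write u = a tau + b n + c e3. The third component decouples and only costs energy,
and for kappa^2 >= 3 the excess over kappa^2 = 3 is (kappa^2 - 3) times a sum of squares, so let
kappa^2 <= 3. Put Q = 2 - c_kappa^2 and P = Q + kappa^2, so that PQ = 4 and P + Q = omega_kappa^2 > 4.
If a and b have mean zero, then
  E - c_kappa^2 |u|^2 = (1 / omega^2) * int ((2 a' + Q b)^2 + (P a - 2 b')^2)
                        + (1 - 4 / omega^2) * int (a'^2 - a^2 + b'^2 - b^2),
which is nonnegative by the Wirtinger inequality; the means contribute (P - 1) and (Q - 1) times their
squares. Equality forces a and b into the span of cos and sin (plus the mean of b when Q = 1), with
2 a' + Q b = 0 up to the mean of b.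

For the Wirtinger inequality pick t0 with f(t0) = f(t0 + pi) and put h = f - f(t0). On the two arcs
between t0 and t0 + pi the substitution r = -l tan (l (t - m)), l < 1, which solves the Riccati equation
r' = -l^2 - r^2, gives h'^2 - l^2 h^2 = (h^2 r)' + (h' - h r)^2; then let l tend to 1.
*)

theory Submission
  imports Defs
begin

section \<open>Indefinite integrals of integrable functions\<close>

text \<open>The constants come from the first Fourier mode. With c = 2 - Q and kappa^2 = P - Q,
  integration by parts turns the planar gap into the integral of a'^2 + b'^2 + 4 a' b + (P - 1) a^2
  + (Q - 1) b^2. On the span of cos and sin, where a' and a have the same norm, this is P a^2 + 4 a'
  b + Q b^2, governed by the matrix with rows (P, 2) and (2, Q). It degenerates exactly when P Q =
  4, and with P - Q = kappa^2 this determines omega and c. The competitor is the constant mode of b,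
  that is u = n, whose gap has the factor Q - 1. At kappa^2 = 3 both modes are optimal at once,
  which explains the threshold and the larger family of minimizers there. The obstacle is
  regularity: \<open>H1_per\<close> supplies the derivative only as an integrand, determined up to a
  null set. The calculus is therefore carried out on indefinite integrals: \<open>AC\<close> pairs a
  function with one representative of its derivative, and the product rule and the uniqueness of the
  derivative are proved at that level.\<close>

definition AC :: "real \<Rightarrow> real \<Rightarrow> (real \<Rightarrow> real) \<Rightarrow> (real \<Rightarrow> real) \<Rightarrow> bool" where
  "AC a b f f' \<longleftrightarrow> f' absolutely_integrable_on {a..b} \<and>
     (\<forall>t\<in>{a..b}. f t = f a + integral {a..t} f')"

lemma absint_integrable:
  fixes f :: "real \<Rightarrow> real"
  shows "f absolutely_integrable_on S \<Longrightarrow> f integrable_on S"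
  by (simp add: absolutely_integrable_on_def)

lemma AC_eq: "AC a b f f' \<Longrightarrow> t \<in> {a..b} \<Longrightarrow> f t = f a + integral {a..t} f'"
  unfolding AC_def by blast

lemma AC_has_integral:
  assumes "AC a b f f'" "a \<le> x" "x \<le> y" "y \<le> b"
  shows "(f' has_integral (f y - f x)) {x..y}"
proof -
  have i: "f' integrable_on {a..b}"
    using assms(1) by (simp add: AC_def absint_integrable)
  have iy: "f' integrable_on {a..y}" "f' integrable_on {x..y}"
    by (rule integrable_subinterval_real[OF i]; use assms in force)+
  have "f y = f a + integral {a..y} f'" "f x = f a + integral {a..x} f'"
    by (rule AC_eq[OF assms(1)]; use assms(2-4) in simp)+
  moreover have "integral {a..x} f' + integral {x..y} f' = integral {a..y} f'"
    by (rule Henstock_Kurzweil_Integration.integral_combine) (use assms iy in auto)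
  ultimately show ?thesis
    using iy(2) by (simp add: has_integral_iff)
qed

lemma AC_absint: "AC a b f f' \<Longrightarrow> f' absolutely_integrable_on {a..b}"
  by (simp add: AC_def)

lemma AC_continuous_on:
  assumes "AC a b f f'"
  shows "continuous_on {a..b} f"
proof -
  have "f' integrable_on {a..b}"
    using assms by (simp add: AC_def absint_integrable)
  then have "continuous_on {a..b} (\<lambda>t. f a + integral {a..t} f')"
    by (intro continuous_intros indefinite_integral_continuous_1)
  then show ?thesis
    by (rule continuous_on_eq) (rule AC_eq[OF assms, symmetric])
qed

lemma AC_intro:
  assumes "f' absolutely_integrable_on {a..b}"
    and "\<And>t. t \<in> {a..b} \<Longrightarrow> (f' has_integral (f t - f a)) {a..t}"
  shows "AC a b f f'"
proof -
  have "f t = f a + integral {a..t} f'" if "t \<in> {a..b}" for t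
    using integral_unique[OF assms(2)[OF that]] by simp
  then show ?thesis unfolding AC_def using assms(1) by blast
qed

lemma AC_subinterval:
  assumes "AC a b f f'" "a \<le> x" "y \<le> b"
  shows "AC x y f f'"
proof (rule AC_intro)
  show "f' absolutely_integrable_on {x..y}"
    using assms by (intro absolutely_integrable_on_subinterval[OF AC_absint[OF assms(1)]]) auto
qed (use assms in \<open>auto intro!: AC_has_integral[OF assms(1)]\<close>)

lemma AC_C1:
  assumes "\<And>t. t \<in> {a..b} \<Longrightarrow> (f has_real_derivative f' t) (at t within {a..b})"
    and "continuous_on {a..b} f'"
  shows "AC a b f f'"
proof (rule AC_intro)
  show "f' absolutely_integrable_on {a..b}"
    using assms(2) by (rule absolutely_integrable_continuous_real)
  fix t assume t: "t \<in> {a..b}"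
  show "(f' has_integral (f t - f a)) {a..t}"
  proof (rule fundamental_theorem_of_calculus)
    fix x assume "x \<in> {a..t}"
    then show "(f has_vector_derivative f' x) (at x within {a..t})"
      using t assms(1)[of x]
      by (auto simp: has_real_derivative_iff_has_vector_derivative
               intro: has_vector_derivative_within_subset)
  qed (use t in auto)
qed

lemma AC_lincomb:
  assumes "AC a b f f'" "AC a b g g'"
  shows "AC a b (\<lambda>t. p * f t + q * g t) (\<lambda>t. p * f' t + q * g' t)"
proof (rule AC_intro)
  show "(\<lambda>t. p * f' t + q * g' t) absolutely_integrable_on {a..b}"
    by (intro set_integral_add(1) set_integrable_mult_right) (use assms in \<open>auto simp: AC_def\<close>)
  fix t assume t: "t \<in> {a..b}"
  have "((\<lambda>t. p * f' t + q * g' t) has_integral (p * (f t - f a) + q * (g t - g a))) {a..t}"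
    using t by (intro has_integral_add has_integral_mult_right AC_has_integral[OF assms(1)] AC_has_integral[OF assms(2)]) auto
  then show "((\<lambda>t. p * f' t + q * g' t) has_integral (p * f t + q * g t - (p * f a + q * g a))) {a..t}"
    by (simp add: algebra_simps)
qed

lemma AC_const: "AC a b (\<lambda>t. c) (\<lambda>t. 0)"
  by (rule AC_intro) auto

text \<open>The increments over a fine partition sum up to at most \<open>e * (N b - N a)\<close> for every \<open>e\<close>.\<close>
lemma const_if_small_increments:
  fixes h N :: "real \<Rightarrow> real"
  assumes "a \<le> b"
    and small: "\<And>e. e > 0 \<Longrightarrow> \<exists>d>0. \<forall>x y. a \<le> x \<and> x \<le> y \<and> y \<le> b \<and> y - x < d \<longrightarrow>
             \<bar>h y - h x\<bar> \<le> e * (N y - N x)"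
  shows "h b = h a"
proof -
  have bound: "\<bar>h b - h a\<bar> \<le> e * (N b - N a)" if e: "e > 0" for e
  proof -
    obtain d where d: "d > 0" "\<And>x y. a \<le> x \<Longrightarrow> x \<le> y \<Longrightarrow> y \<le> b \<Longrightarrow> y - x < d \<Longrightarrow>
             \<bar>h y - h x\<bar> \<le> e * (N y - N x)"
      using small[OF e] by blast
    obtain n :: nat where n: "(b - a) / d < real n" using reals_Archimedean2 by blast
    have "(b - a) / d \<ge> 0" using d(1) assms(1) by simp
    then have n0: "n > 0" using n by (cases n) auto
    define s where "s = (b - a) / n"
    have s: "0 \<le> s" "a + real n * s = b"
      using n0 assms(1) by (auto simp: s_def)
    have "b - a < d * real n" using n d(1) by (simp add: pos_divide_less_eq mult.commute)
    then have sd: "s < d" using n0 by (simp add: s_def pos_divide_less_eq)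
    have "i \<le> n \<Longrightarrow> \<bar>h (a + real i * s) - h a\<bar> \<le> e * (N (a + real i * s) - N a)" for i
    proof (induction i)
      case (Suc i)
      have "real (Suc i) * s \<le> real n * s"
        using Suc.prems s(1) by (intro mult_right_mono) auto
      then have "\<bar>h (a + real (Suc i) * s) - h (a + real i * s)\<bar>
          \<le> e * (N (a + real (Suc i) * s) - N (a + real i * s))"
        using s sd by (intro d(2)) (simp_all add: distrib_right)
      moreover have "\<bar>h (a + real i * s) - h a\<bar> \<le> e * (N (a + real i * s) - N a)"
        using Suc by simp
      ultimately show ?case by (simp add: right_diff_distrib)
    qed simp
    from this[of n] show ?thesis using s(2) by simp
  qed
  show ?thesis
  proof (rule ccontr)
    assume "h b \<noteq> h a"
    then have p: "\<bar>h b - h a\<bar> > 0" by simp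
    \<comment> \<open>The maximum with 1 keeps the tolerance
      \<open>\<bar>h b - h a\<bar> / (2 * m)\<close> positive even if \<open>N b - N a\<close> is
      not.\<close>
    define m where "m = max 1 (N b - N a)"
    have m: "m > 0" "N b - N a \<le> m" by (auto simp: m_def)
    have "\<bar>h b - h a\<bar> \<le> (\<bar>h b - h a\<bar> / (2 * m)) * (N b - N a)"
      by (rule bound) (use p m in simp)
    also have "\<dots> \<le> (\<bar>h b - h a\<bar> / (2 * m)) * m"
      by (rule mult_left_mono) (use p m in auto)
    also have "\<dots> = \<bar>h b - h a\<bar> / 2"
      using m by simp
    finally show False using p by simp
  qed
qed

section \<open>Product rule for indefinite integrals\<close>

lemma absint_mult_continuous:
  fixes f g :: "real \<Rightarrow> real"
  assumes "continuous_on {a..b} f" "g absolutely_integrable_on {a..b}"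
  shows "(\<lambda>t. f t * g t) absolutely_integrable_on {a..b}"
proof (rule absolutely_integrable_bounded_measurable_product_real[OF _ _ _ assms(2)])
  show "f \<in> borel_measurable (lebesgue_on {a..b})"
    using assms(1) by (intro continuous_imp_measurable_on_sets_lebesgue) auto
  show "bounded (f ` {a..b})"
    using assms(1) by (intro compact_imp_bounded compact_continuous_image) auto
qed auto

text \<open>Freezing \<open>g\<close> at the right end and \<open>f\<close> at the left end is
  exact: f y g y - f x g x = g y (f y - f x) + f x (g y - g x). Only the oscillation of
  \<open>f\<close> and \<open>g\<close> on the interval remains as error, weighted by |f'| +
  |g'|.\<close>

lemma AC_mult_increment:
  assumes f: "AC x y f f'" and g: "AC x y g g'" and xy: "x \<le> y"
    and osc: "\<And>s. s \<in> {x..y} \<Longrightarrow> \<bar>f s - f x\<bar> \<le> e" "\<And>s. s \<in> {x..y} \<Longrightarrow> \<bar>g s - g y\<bar> \<le> e"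
  shows "\<bar>f y * g y - f x * g x - integral {x..y} (\<lambda>s. f' s * g s + f s * g' s)\<bar>
           \<le> e * integral {x..y} (\<lambda>s. \<bar>f' s\<bar> + \<bar>g' s\<bar>)"
proof -
  have cf: "continuous_on {x..y} f" and cg: "continuous_on {x..y} g"
    using f g AC_continuous_on by auto
  have af: "f' absolutely_integrable_on {x..y}" and ag: "g' absolutely_integrable_on {x..y}"
    using f g AC_absint by auto
  have p: "(\<lambda>s. g s * f' s) integrable_on {x..y}" "(\<lambda>s. f s * g' s) integrable_on {x..y}"
    using absint_mult_continuous[OF cg af] absint_mult_continuous[OF cf ag]
    by (auto intro: absint_integrable)
  then have i1: "(\<lambda>s. f' s * g s + f s * g' s) integrable_on {x..y}"
    using integrable_add[OF p] by (simp add: mult.commute)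
  have i2: "(\<lambda>s. \<bar>f' s\<bar> + \<bar>g' s\<bar>) integrable_on {x..y}"
    using af ag by (intro integrable_add) (auto simp: absolutely_integrable_on_def)
  have "((\<lambda>s. g y * f' s + f x * g' s) has_integral (g y * (f y - f x) + f x * (g y - g x))) {x..y}"
    using xy by (intro has_integral_add has_integral_mult_right AC_has_integral[OF f] AC_has_integral[OF g]) auto
  from has_integral_diff[OF this integrable_integral[OF i1]]
  have hi: "((\<lambda>s. g y * f' s + f x * g' s - (f' s * g s + f s * g' s)) has_integral
     (f y * g y - f x * g x - integral {x..y} (\<lambda>s. f' s * g s + f s * g' s))) {x..y}"
    by (simp add: algebra_simps)
  have "norm (integral {x..y} (\<lambda>s. g y * f' s + f x * g' s - (f' s * g s + f s * g' s)))
     \<le> integral {x..y} (\<lambda>s. e * (\<bar>f' s\<bar> + \<bar>g' s\<bar>))"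
  proof (rule integral_norm_bound_integral)
    show "(\<lambda>s. g y * f' s + f x * g' s - (f' s * g s + f s * g' s)) integrable_on {x..y}"
      using hi by blast
    show "(\<lambda>s. e * (\<bar>f' s\<bar> + \<bar>g' s\<bar>)) integrable_on {x..y}"
      using integrable_cmul[OF i2, of e] by simp
    fix s assume s: "s \<in> {x..y}"
    have "norm (g y * f' s + f x * g' s - (f' s * g s + f s * g' s))
        = \<bar>(g y - g s) * f' s + (f x - f s) * g' s\<bar>"
      by (simp add: algebra_simps)
    also have "\<dots> \<le> \<bar>(g y - g s) * f' s\<bar> + \<bar>(f x - f s) * g' s\<bar>"
      by (rule abs_triangle_ineq)
    also have "\<dots> = \<bar>g s - g y\<bar> * \<bar>f' s\<bar> + \<bar>f s - f x\<bar> * \<bar>g' s\<bar>"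
      by (simp only: abs_mult abs_minus_commute)
    also have "\<dots> \<le> e * \<bar>f' s\<bar> + e * \<bar>g' s\<bar>"
      using osc[OF s] by (intro add_mono mult_right_mono) auto
    finally show "norm (g y * f' s + f x * g' s - (f' s * g s + f s * g' s)) \<le> e * (\<bar>f' s\<bar> + \<bar>g' s\<bar>)"
      by (simp add: algebra_simps)
  qed
  then show ?thesis
    using hi by (simp add: integral_unique)
qed

text \<open>The product minus the candidate integral has increments controlled by
  \<open>AC_mult_increment\<close>; uniform continuity makes the factor e arbitrarily small, so
  \<open>const_if_small_increments\<close> applies with the indefinite integral of |f'| + |g'| as
  \<open>N\<close>. No pointwise differentiation enters.\<close>

lemma AC_mult:
  assumes f: "AC a b f f'" and g: "AC a b g g'"
  shows "AC a b (\<lambda>t. f t * g t) (\<lambda>t. f' t * g t + f t * g' t)"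
proof (rule AC_intro)
  have cf: "continuous_on {a..b} f" and cg: "continuous_on {a..b} g"
    using f g AC_continuous_on by auto
  have af: "f' absolutely_integrable_on {a..b}" and ag: "g' absolutely_integrable_on {a..b}"
    using f g AC_absint by auto
  show ai: "(\<lambda>t. f' t * g t + f t * g' t) absolutely_integrable_on {a..b}"
    using set_integral_add(1)[OF absint_mult_continuous[OF cg af] absint_mult_continuous[OF cf ag]]
    by (simp add: mult.commute)
  let ?k = "\<lambda>t. f' t * g t + f t * g' t"
  let ?n = "\<lambda>s. \<bar>f' s\<bar> + \<bar>g' s\<bar>"
  have ik: "?k integrable_on {a..b}" using ai by (rule absint_integrable)
  have inn: "?n integrable_on {a..b}"
    using af ag by (intro integrable_add) (auto simp: absolutely_integrable_on_def)
  fix t assume t: "t \<in> {a..b}"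
  let ?h = "\<lambda>x. f x * g x - integral {a..x} ?k"
  have uf: "uniformly_continuous_on {a..b} f" and ug: "uniformly_continuous_on {a..b} g"
    using cf cg by (auto intro: compact_uniformly_continuous)
  have "?h t = ?h a"
  proof (rule const_if_small_increments[where h = ?h and N = "\<lambda>x. integral {a..x} ?n"])
    fix e :: real assume e: "e > 0"
    obtain d1 where d1: "d1 > 0" "\<And>x y. x \<in> {a..b} \<Longrightarrow> y \<in> {a..b} \<Longrightarrow> dist y x < d1 \<Longrightarrow> dist (f y) (f x) < e"
      using uf e unfolding uniformly_continuous_on_def by metis
    obtain d2 where d2: "d2 > 0" "\<And>x y. x \<in> {a..b} \<Longrightarrow> y \<in> {a..b} \<Longrightarrow> dist y x < d2 \<Longrightarrow> dist (g y) (g x) < e"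
      using ug e unfolding uniformly_continuous_on_def by metis
    show "\<exists>d>0. \<forall>x y. a \<le> x \<and> x \<le> y \<and> y \<le> t \<and> y - x < d \<longrightarrow>
       \<bar>?h y - ?h x\<bar> \<le> e * (integral {a..y} ?n - integral {a..x} ?n)"
    proof (intro exI[of _ "min d1 d2"] conjI allI impI)
      fix x y assume xy: "a \<le> x \<and> x \<le> y \<and> y \<le> t \<and> y - x < min d1 d2"
      then have xyb: "a \<le> x" "x \<le> y" "y \<le> b" using t by auto
      have c: "integral {a..x} ?n + integral {x..y} ?n = integral {a..y} ?n"
              "integral {a..x} ?k + integral {x..y} ?k = integral {a..y} ?k"
        using xyb integrable_subinterval_real[OF inn, of a y] integrable_subinterval_real[OF ik, of a y]
        by (auto intro!: Henstock_Kurzweil_Integration.integral_combine)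
      have "\<bar>f y * g y - f x * g x - integral {x..y} ?k\<bar> \<le> e * integral {x..y} ?n"
      proof (rule AC_mult_increment)
        show "AC x y f f'" "AC x y g g'" "x \<le> y"
          using xyb f g by (auto intro: AC_subinterval)
        show "\<bar>f s - f x\<bar> \<le> e" if "s \<in> {x..y}" for s
          using d1(2)[of x s] that xy xyb by (auto simp: dist_real_def)
        show "\<bar>g s - g y\<bar> \<le> e" if "s \<in> {x..y}" for s
          using d2(2)[of y s] that xy xyb by (auto simp: dist_real_def)
      qed
      moreover have "?h y - ?h x = f y * g y - f x * g x - integral {x..y} ?k"
        "integral {a..y} ?n - integral {a..x} ?n = integral {x..y} ?n"
        using c by linarith+
      ultimately show "\<bar>?h y - ?h x\<bar> \<le> e * (integral {a..y} ?n - integral {a..x} ?n)"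
        by presburger
    qed (use d1 d2 in auto)
  qed (use t in auto)
  then show "(?k has_integral (f t * g t - f a * g a)) {a..t}"
    using t integrable_subinterval_real[OF ik, of a t] by (auto simp: has_integral_iff)
qed

text \<open>The difference of the two derivatives integrates to zero over every subinterval, and
  almost every point is a point where shrinking averages recover the integrand.\<close>

lemma AC_derivative_unique:
  assumes f: "AC a b f f'" and g: "AC a b f g'"
  obtains N where "negligible N" "\<And>t. t \<in> {a..b} - N \<Longrightarrow> f' t = g' t"
proof -
  \<comment> \<open>Extension by zero makes the integral vanish over every interval of the line,
    including those that cross an endpoint.\<close>
  define d where "d = (\<lambda>t. if t \<in> {a..b} then f' t - g' t else 0)"
  have z: "((\<lambda>t. f' t - g' t) has_integral 0) {x..y}" if "a \<le> x" "x \<le> y" "y \<le> b" for x y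
    using has_integral_diff[OF AC_has_integral[OF f] AC_has_integral[OF g], of x y] that by simp
  have "((\<lambda>t. if t \<in> {a..b} then f' t - g' t else 0) has_integral 0) {x..y}" for x y
  proof -
    have "((\<lambda>t. f' t - g' t) has_integral 0) ({a..b} \<inter> {x..y})"
      by (cases "max a x \<le> min b y") (use z[of "max a x" "min b y"] in auto)
    then show ?thesis using has_integral_restrict_Int[of "{a..b}" "\<lambda>t. f' t - g' t" 0 "{x..y}"] by simp
  qed
  then have dz: "(d has_integral 0) (cbox x y)" for x y
    unfolding d_def by simp
  obtain N where N: "negligible N"
     "\<And>x e. \<lbrakk>x \<notin> N; 0 < e\<rbrakk> \<Longrightarrow> \<exists>\<delta>>0. \<forall>h. 0 < h \<and> h < \<delta> \<longrightarrow>
         norm(integral (cbox x (x + h *\<^sub>R One)) d /\<^sub>R h ^ DIM(real) - d x) < e"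
    using integrable_ccontinuous_explicit[of d] dz by blast
  show thesis
  proof (rule that[OF N(1)])
    fix t assume t: "t \<in> {a..b} - N"
    have "d t = 0"
    proof (rule ccontr)
      assume "d t \<noteq> 0"
      then obtain \<delta> where \<delta>: "\<delta> > 0" "\<forall>h. 0 < h \<and> h < \<delta> \<longrightarrow>
         norm(integral (cbox t (t + h *\<^sub>R One)) d /\<^sub>R h ^ DIM(real) - d t) < norm (d t)"
        using N(2)[of t "norm (d t)"] t by auto
      have "norm(integral (cbox t (t + (\<delta>/2) *\<^sub>R One)) d /\<^sub>R (\<delta>/2) ^ DIM(real) - d t) < norm (d t)"
        using \<delta>(1) by (intro \<delta>(2)[rule_format]) simp
      then show False using dz[THEN integral_unique] by simp
    qed
    then show "f' t = g' t" using t by (simp add: d_def)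
  qed
qed

section \<open>Square integrable functions and the Wirtinger inequality\<close>

text \<open>Measurability is a separate condition because integrability of the square does not see
  the sign of \<open>f\<close>.\<close>

definition L2 :: "real \<Rightarrow> real \<Rightarrow> (real \<Rightarrow> real) \<Rightarrow> bool" where
  "L2 a b f \<longleftrightarrow> f \<in> borel_measurable (lebesgue_on {a..b}) \<and> (\<lambda>t. (f t)\<^sup>2) integrable_on {a..b}"

lemma L2_mult_integrable:
  assumes "L2 a b f" "L2 a b g"
  shows "(\<lambda>t. f t * g t) integrable_on {a..b}"
proof (rule absint_integrable, rule measurable_bounded_by_integrable_imp_absolutely_integrable)
  show "(\<lambda>t. f t * g t) \<in> borel_measurable (lebesgue_on {a..b})"
    using assms by (auto simp: L2_def intro: borel_measurable_times)
  show "(\<lambda>t. (f t)\<^sup>2 + (g t)\<^sup>2) integrable_on {a..b}"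
    using assms by (auto simp: L2_def intro: integrable_add)
  fix t
  have "0 \<le> (\<bar>f t\<bar> - \<bar>g t\<bar>)\<^sup>2" by simp
  then have "2 * (\<bar>f t\<bar> * \<bar>g t\<bar>) \<le> (f t)\<^sup>2 + (g t)\<^sup>2"
    by (simp add: power2_diff)
  moreover have "0 \<le> \<bar>f t\<bar> * \<bar>g t\<bar>" by simp
  ultimately show "norm (f t * g t) \<le> (f t)\<^sup>2 + (g t)\<^sup>2"
    unfolding real_norm_def abs_mult by linarith
qed auto

lemma L2_lincomb:
  assumes f: "L2 a b f" and g: "L2 a b g"
  shows "L2 a b (\<lambda>t. p * f t + q * g t)"
  unfolding L2_def
proof
  show "(\<lambda>t. p * f t + q * g t) \<in> borel_measurable (lebesgue_on {a..b})"
    using assms by (auto simp: L2_def intro!: borel_measurable_add borel_measurable_times)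
  have "(\<lambda>t. p\<^sup>2 * (f t)\<^sup>2 + 2 * p * q * (f t * g t) + q\<^sup>2 * (g t)\<^sup>2) integrable_on {a..b}"
    using f g L2_mult_integrable[OF f g]
    by (intro integrable_add integrable_on_mult_right) (auto simp: L2_def)
  then show "(\<lambda>t. (p * f t + q * g t)\<^sup>2) integrable_on {a..b}"
    by (rule integrable_eq) (simp add: power2_eq_square algebra_simps)
qed

lemma L2_continuous: "continuous_on {a..b} f \<Longrightarrow> L2 a b f"
  unfolding L2_def
  by (auto intro!: continuous_imp_measurable_on_sets_lebesgue integrable_continuous_real continuous_intros)

lemma L2_mult_continuous:
  assumes c: "continuous_on {a..b} c" and f: "L2 a b f"
  shows "L2 a b (\<lambda>t. c t * f t)"
  unfolding L2_def
proof
  have mc: "c \<in> borel_measurable (lebesgue_on {a..b})"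
    using c by (intro continuous_imp_measurable_on_sets_lebesgue) auto
  then show "(\<lambda>t. c t * f t) \<in> borel_measurable (lebesgue_on {a..b})"
    using f by (auto simp: L2_def intro!: borel_measurable_times)
  have "(\<lambda>t. (f t)\<^sup>2) absolutely_integrable_on {a..b}"
    using f by (intro nonnegative_absolutely_integrable_1) (auto simp: L2_def)
  then have "(\<lambda>t. (c t)\<^sup>2 * (f t)\<^sup>2) absolutely_integrable_on {a..b}"
    using c by (intro absint_mult_continuous continuous_intros)
  then show "(\<lambda>t. (c t * f t)\<^sup>2) integrable_on {a..b}"
    by (simp add: power_mult_distrib absint_integrable)
qed

lemma L2_subinterval:
  assumes "L2 a b f" "a \<le> x" "y \<le> b"
  shows "L2 x y f"
  unfolding L2_def
proof
  have s: "{x..y} \<subseteq> {a..b}" using assms by auto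
  show "f \<in> borel_measurable (lebesgue_on {x..y})"
    using assms(1) s by (auto simp: L2_def intro: measurable_restrict_mono)
  show "(\<lambda>t. (f t)\<^sup>2) integrable_on {x..y}"
    using assms(1) s by (auto simp: L2_def intro: integrable_subinterval_real)
qed

lemma L2_square_zero:
  assumes f: "L2 a b f" and z: "integral {a..b} (\<lambda>t. (f t)\<^sup>2) = 0"
  obtains N where "negligible N" "\<And>t. t \<in> {a..b} - N \<Longrightarrow> f t = 0"
proof -
  have ai: "(\<lambda>t. (f t)\<^sup>2) absolutely_integrable_on {a..b}"
    using f by (intro nonnegative_absolutely_integrable_1) (auto simp: L2_def)
  have i: "integrable (lebesgue_on {a..b}) (\<lambda>t. (f t)\<^sup>2)"
    by (rule absolutely_integrable_imp_integrable[OF ai]) simp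
  have "integral\<^sup>L (lebesgue_on {a..b}) (\<lambda>t. (f t)\<^sup>2) = 0"
    using lebesgue_integral_eq_integral[OF i] z by simp
  then have "AE t in lebesgue_on {a..b}. (f t)\<^sup>2 = 0"
    using integral_nonneg_eq_0_iff_AE[OF i] by simp
  then have "AE t in lebesgue. t \<in> {a..b} \<longrightarrow> f t = 0"
    by (simp add: AE_restrict_space_iff)
  then obtain N where "N \<in> null_sets lebesgue" "{t. \<not> (t \<in> {a..b} \<longrightarrow> f t = 0)} \<subseteq> N"
    by (auto simp: eventually_ae_filter)
  then show thesis
    by (intro that[of N]) (auto simp: negligible_iff_null_sets)
qed

text \<open>Since \<open>l < 1\<close>, the angle \<open>l * (t - m)\<close> stays strictly inside
  (-pi/2, pi/2) even at the ends of an arc of length pi, so \<open>r\<close> is bounded there. The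
  boundary terms are kept because an arc that wraps around the period is treated in two pieces, at
  whose common end \<open>h\<close> need not vanish.\<close>

lemma Wirtinger_arc:
  assumes h: "AC x y h h'" "L2 x y h'" and xy: "x \<le> y" and l: "0 < l" "l < 1"
    and m: "\<And>t. t \<in> {x..y} \<Longrightarrow> \<bar>t - m\<bar> \<le> pi / 2"
  defines "r \<equiv> \<lambda>t. - l * tan (l * (t - m))"
  shows "l\<^sup>2 * integral {x..y} (\<lambda>t. (h t)\<^sup>2) + ((h y)\<^sup>2 * r y - (h x)\<^sup>2 * r x)
           \<le> integral {x..y} (\<lambda>t. (h' t)\<^sup>2)"
proof -
  have cosp: "cos (l * (t - m)) > 0" if "t \<in> {x..y}" for t
  proof -
    have "\<bar>l * (t - m)\<bar> = l * \<bar>t - m\<bar>" using l by (simp add: abs_mult)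
    also have "\<dots> \<le> l * (pi / 2)" using m[OF that] l by (intro mult_left_mono) auto
    also have "\<dots> < pi / 2" using l by simp
    finally show ?thesis by (intro cos_gt_zero_pi) auto
  qed
  let ?r' = "\<lambda>t. - l * (l * (inverse (cos (l * (t - m))))\<^sup>2)"
  have ch: "continuous_on {x..y} h" using h(1) by (rule AC_continuous_on)
  have AC_r: "AC x y r ?r'"
  proof (rule AC_C1)
    fix t assume "t \<in> {x..y}"
    from cosp[OF this] show "(r has_real_derivative ?r' t) (at t within {x..y})"
      unfolding r_def by (auto intro!: derivative_eq_intros simp: power_inverse)
  next
    show "continuous_on {x..y} ?r'"
      using cosp by (intro continuous_intros) (auto simp: less_le)
  qed
  have cr: "continuous_on {x..y} r" using AC_r by (rule AC_continuous_on)
  have r': "?r' t = - l\<^sup>2 - (r t)\<^sup>2" if "t \<in> {x..y}" for t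
  proof -
    have "(inverse (cos (l * (t - m))))\<^sup>2 = 1 + (tan (l * (t - m)))\<^sup>2"
      using tan_sec[of "l * (t - m)"] cosp[OF that] by auto
    then show ?thesis by (simp add: r_def power_mult_distrib power2_eq_square algebra_simps)
  qed
  have "((\<lambda>t. (h' t * h t + h t * h' t) * r t + (h t * h t) * ?r' t) has_integral
           (h y * h y * r y - h x * h x * r x)) {x..y}"
    by (rule AC_has_integral[OF AC_mult[OF AC_mult[OF h(1) h(1)] AC_r]]) (use xy in auto)
  moreover have "((\<lambda>t. (h t)\<^sup>2) has_integral integral {x..y} (\<lambda>t. (h t)\<^sup>2)) {x..y}"
    using ch by (intro integrable_integral integrable_continuous_real continuous_intros)
  moreover have "((\<lambda>t. (h' t)\<^sup>2) has_integral integral {x..y} (\<lambda>t. (h' t)\<^sup>2)) {x..y}"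
    using h(2) by (intro integrable_integral) (simp add: L2_def)
  ultimately have hi: "((\<lambda>t. (h' t)\<^sup>2 - (l\<^sup>2 * (h t)\<^sup>2 + ((h' t * h t + h t * h' t) * r t + (h t * h t) * ?r' t)))
     has_integral (integral {x..y} (\<lambda>t. (h' t)\<^sup>2) - (l\<^sup>2 * integral {x..y} (\<lambda>t. (h t)\<^sup>2)
        + (h y * h y * r y - h x * h x * r x)))) {x..y}"
    by (intro has_integral_diff has_integral_add has_integral_mult_right)
  have "0 \<le> integral {x..y} (\<lambda>t. (h' t)\<^sup>2) - (l\<^sup>2 * integral {x..y} (\<lambda>t. (h t)\<^sup>2)
        + (h y * h y * r y - h x * h x * r x))"
  proof (rule has_integral_nonneg[OF hi])
    fix t assume t: "t \<in> {x..y}"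
    have "(h' t)\<^sup>2 - (l\<^sup>2 * (h t)\<^sup>2 + ((h' t * h t + h t * h' t) * r t + (h t * h t) * ?r' t))
      = (h' t - h t * r t)\<^sup>2"
      unfolding r'[OF t] by (simp add: power2_eq_square algebra_simps)
    then show "0 \<le> (h' t)\<^sup>2 - (l\<^sup>2 * (h t)\<^sup>2 + ((h' t * h t + h t * h' t) * r t + (h t * h t) * ?r' t))"
      by simp
  qed
  then show ?thesis by (simp add: power2_eq_square)
qed

section \<open>Real-valued periodic H^1 functions and the full Wirtinger inequality\<close>

definition H1p :: "(real \<Rightarrow> real) \<Rightarrow> (real \<Rightarrow> real) \<Rightarrow> bool" where
  "H1p f f' \<longleftrightarrow> AC (- pi) pi f f' \<and> L2 (- pi) pi f' \<and> f pi = f (- pi)"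

lemma H1p_lincomb:
  "H1p f f' \<Longrightarrow> H1p g g' \<Longrightarrow> H1p (\<lambda>t. p * f t + q * g t) (\<lambda>t. p * f' t + q * g' t)"
  by (auto simp: H1p_def intro: AC_lincomb L2_lincomb)

lemma H1p_const: "H1p (\<lambda>t. c) (\<lambda>t. 0)"
  by (auto simp: H1p_def intro: AC_const L2_continuous)

lemma H1p_C1:
  assumes "\<And>t. t \<in> {- pi..pi} \<Longrightarrow> (f has_real_derivative f' t) (at t within {- pi..pi})"
    and "continuous_on {- pi..pi} f'" "f pi = f (- pi)"
  shows "H1p f f'"
  using assms by (auto simp: H1p_def intro!: AC_C1 L2_continuous)

lemma H1p_continuous_on: "H1p f f' \<Longrightarrow> continuous_on {- pi..pi} f"
  by (auto simp: H1p_def intro: AC_continuous_on)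

lemma H1p_L2: "H1p f f' \<Longrightarrow> L2 (- pi) pi f" "H1p f f' \<Longrightarrow> L2 (- pi) pi f'"
  by (auto simp: H1p_def intro: AC_continuous_on L2_continuous)

lemma H1p_integral_deriv: "H1p f f' \<Longrightarrow> (f' has_integral 0) {- pi..pi}"
  using AC_has_integral[of "- pi" pi f f' "- pi" pi] by (simp add: H1p_def)

lemma H1p_by_parts:
  assumes "H1p f f'" "H1p g g'"
  shows "integral {- pi..pi} (\<lambda>t. f' t * g t) = - integral {- pi..pi} (\<lambda>t. f t * g' t)"
proof -
  have "((\<lambda>t. f' t * g t + f t * g' t) has_integral (f pi * g pi - f (- pi) * g (- pi))) {- pi..pi}"
    using assms by (intro AC_has_integral[OF AC_mult]) (auto simp: H1p_def)
  then have "integral {- pi..pi} (\<lambda>t. f' t * g t + f t * g' t) = 0"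
    using assms by (auto simp: H1p_def integral_unique)
  moreover have "(\<lambda>t. f' t * g t) integrable_on {- pi..pi}" "(\<lambda>t. f t * g' t) integrable_on {- pi..pi}"
    using assms H1p_L2 L2_mult_integrable by blast+
  ultimately show ?thesis by (simp add: integral_add)
qed

lemma integral_square_lincomb:
  assumes "L2 a b f" "L2 a b g"
  shows "integral {a..b} (\<lambda>t. (p * f t + q * g t)\<^sup>2) =
     p\<^sup>2 * integral {a..b} (\<lambda>t. (f t)\<^sup>2) + 2 * p * q * integral {a..b} (\<lambda>t. f t * g t)
       + q\<^sup>2 * integral {a..b} (\<lambda>t. (g t)\<^sup>2)"
proof -
  have "((\<lambda>t. p\<^sup>2 * (f t)\<^sup>2 + 2 * p * q * (f t * g t) + q\<^sup>2 * (g t)\<^sup>2) has_integral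
     p\<^sup>2 * integral {a..b} (\<lambda>t. (f t)\<^sup>2) + 2 * p * q * integral {a..b} (\<lambda>t. f t * g t)
       + q\<^sup>2 * integral {a..b} (\<lambda>t. (g t)\<^sup>2)) {a..b}"
    using assms L2_mult_integrable[OF assms]
    by (intro has_integral_add has_integral_mult_right integrable_integral) (auto simp: L2_def)
  moreover have "(\<lambda>t. p\<^sup>2 * (f t)\<^sup>2 + 2 * p * q * (f t * g t) + q\<^sup>2 * (g t)\<^sup>2) = (\<lambda>t. (p * f t + q * g t)\<^sup>2)"
    by (simp add: fun_eq_iff power2_eq_square algebra_simps)
  ultimately show ?thesis by (simp add: integral_unique)
qed

text \<open>It is enough to bound the square integral of f - f(t0): among all constants the mean is
  the closest to f in L^2, so the left-hand side, the variance integral, is at most that of f -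
  f(t0).\<close>

lemma Wirtinger:
  assumes "H1p f f'"
  shows "integral {- pi..pi} (\<lambda>t. (f t)\<^sup>2) - (integral {- pi..pi} f)\<^sup>2 / (2 * pi)
           \<le> integral {- pi..pi} (\<lambda>t. (f' t)\<^sup>2)"
proof -
  have cf: "continuous_on {- pi..pi} f" using assms by (rule H1p_continuous_on)
  have per: "f pi = f (- pi)" using assms by (simp add: H1p_def)
  let ?d = "\<lambda>t. f (t + pi) - f t"
  have cd: "continuous_on {- pi..0} ?d"
    by (intro continuous_intros continuous_on_compose2[OF cf] continuous_on_subset[OF cf]) auto
  \<comment> \<open>By periodicity the difference takes opposite values at -pi and 0, so it has a
    zero between them.\<close>
  have "\<exists>t0. - pi \<le> t0 \<and> t0 \<le> 0 \<and> ?d t0 = 0"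
  proof (cases "?d (- pi) \<le> 0")
    case True
    then show ?thesis using per cd by (intro IVT') auto
  next
    case False
    then show ?thesis using per cd by (intro IVT2') auto
  qed
  then obtain t0 where t0: "- pi \<le> t0" "t0 \<le> 0" "f (t0 + pi) = f t0" by auto
  define h where "h = (\<lambda>t. f t - f t0)"
  have "H1p h f'"
    using H1p_lincomb[OF assms H1p_const[of 1], of 1 "- f t0"] by (simp add: h_def)
  then have h: "AC (- pi) pi h f'" "L2 (- pi) pi f'" by (auto simp: H1p_def)
  have hz: "h t0 = 0" "h (t0 + pi) = 0" "h pi = h (- pi)" using t0 per by (auto simp: h_def)
  have ch: "continuous_on {- pi..pi} h" using h(1) by (rule AC_continuous_on)
  have split: "integral {- pi..t0} k + integral {t0..t0 + pi} k + integral {t0 + pi..pi} k = integral {- pi..pi} k"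
    if k: "k integrable_on {- pi..pi}" for k :: "real \<Rightarrow> real"
  proof -
    have "k integrable_on {- pi..t0 + pi}" using t0 by (intro integrable_subinterval_real[OF k]) auto
    then show ?thesis
      using Henstock_Kurzweil_Integration.integral_combine[of "- pi" t0 "t0 + pi" k]
        Henstock_Kurzweil_Integration.integral_combine[of "- pi" "t0 + pi" pi k] k t0 by simp
  qed
  have ih: "(\<lambda>t. (h t)\<^sup>2) integrable_on {- pi..pi}"
    using ch by (intro integrable_continuous_real continuous_intros)
  have "z * integral {- pi..pi} (\<lambda>t. (h t)\<^sup>2) \<le> integral {- pi..pi} (\<lambda>t. (f' t)\<^sup>2)"
    if z: "0 < z" "z < 1" for z
  proof -
    define l where "l = sqrt z"
    have l: "0 < l" "l < 1" "l\<^sup>2 = z" using z by (auto simp: l_def)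
    have sub: "AC x y h f'" "L2 x y f'" if "- pi \<le> x" "y \<le> pi" for x y
      using h that by (auto intro: AC_subinterval L2_subinterval)
    \<comment> \<open>The arc from t0 + pi to t0 + 2 pi is cut at the point where pi and -pi are
      identified. The midpoints used for its two pieces differ by 2 pi, so \<open>r\<close> agrees
      on both sides of the cut and the boundary terms there cancel; all others vanish with
      \<open>h\<close>.\<close>
    have "pi - (t0 + 3 * pi / 2) = - pi - (t0 - pi / 2)" by simp
    then have eq: "tan (l * (pi - (t0 + 3 * pi / 2))) = tan (l * (- pi - (t0 - pi / 2)))" by simp
    have m2: "\<bar>t - (t0 + pi / 2)\<bar> \<le> pi / 2" if "t \<in> {t0..t0 + pi}" for t
      using that t0 unfolding abs_le_iff atLeastAtMost_iff by linarith
    have m3: "\<bar>t - (t0 + 3 * pi / 2)\<bar> \<le> pi / 2" if "t \<in> {t0 + pi..pi}" for t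
      using that t0 unfolding abs_le_iff atLeastAtMost_iff by linarith
    have m1: "\<bar>t - (t0 - pi / 2)\<bar> \<le> pi / 2" if "t \<in> {- pi..t0}" for t
      using that t0 unfolding abs_le_iff atLeastAtMost_iff by linarith
    have "l\<^sup>2 * integral {- pi..t0} (\<lambda>t. (h t)\<^sup>2)
        + ((h t0)\<^sup>2 * (- l * tan (l * (t0 - (t0 - pi / 2)))) - (h (- pi))\<^sup>2 * (- l * tan (l * (- pi - (t0 - pi / 2)))))
        \<le> integral {- pi..t0} (\<lambda>t. (f' t)\<^sup>2)"
      by (rule Wirtinger_arc) (use sub[of "- pi" t0] t0 l m1 in auto)
    moreover have "l\<^sup>2 * integral {t0..t0 + pi} (\<lambda>t. (h t)\<^sup>2)
        + ((h (t0 + pi))\<^sup>2 * (- l * tan (l * (t0 + pi - (t0 + pi / 2)))) - (h t0)\<^sup>2 * (- l * tan (l * (t0 - (t0 + pi / 2)))))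
        \<le> integral {t0..t0 + pi} (\<lambda>t. (f' t)\<^sup>2)"
      by (rule Wirtinger_arc) (use sub[of t0 "t0 + pi"] t0 l m2 in auto)
    moreover have "l\<^sup>2 * integral {t0 + pi..pi} (\<lambda>t. (h t)\<^sup>2)
        + ((h pi)\<^sup>2 * (- l * tan (l * (pi - (t0 + 3 * pi / 2)))) - (h (t0 + pi))\<^sup>2 * (- l * tan (l * (t0 + pi - (t0 + 3 * pi / 2)))))
        \<le> integral {t0 + pi..pi} (\<lambda>t. (f' t)\<^sup>2)"
      by (rule Wirtinger_arc) (use sub[of "t0 + pi" pi] t0 l m3 in auto)
    ultimately have "l\<^sup>2 * (integral {- pi..t0} (\<lambda>t. (h t)\<^sup>2) + integral {t0..t0 + pi} (\<lambda>t. (h t)\<^sup>2)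
          + integral {t0 + pi..pi} (\<lambda>t. (h t)\<^sup>2))
        \<le> integral {- pi..t0} (\<lambda>t. (f' t)\<^sup>2) + integral {t0..t0 + pi} (\<lambda>t. (f' t)\<^sup>2)
          + integral {t0 + pi..pi} (\<lambda>t. (f' t)\<^sup>2)"
      unfolding hz eq distrib_left by simp
    then show ?thesis
      unfolding split[OF ih] l(3) using split[of "\<lambda>t. (f' t)\<^sup>2"] h(2) by (simp add: L2_def)
  qed
  then have le: "integral {- pi..pi} (\<lambda>t. (h t)\<^sup>2) \<le> integral {- pi..pi} (\<lambda>t. (f' t)\<^sup>2)"
    by (rule field_le_mult_one_interval)
  have "integral {- pi..pi} (\<lambda>t. (h t)\<^sup>2) = integral {- pi..pi} (\<lambda>t. (f t)\<^sup>2)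
      - 2 * f t0 * integral {- pi..pi} f + 2 * pi * (f t0)\<^sup>2"
    using integral_square_lincomb[OF L2_continuous[OF cf] L2_continuous[of "- pi" pi "\<lambda>t. 1"], of 1 "- f t0"]
    by (simp add: h_def)
  moreover have "2 * pi * (f t0)\<^sup>2 - 2 * f t0 * integral {- pi..pi} f + (integral {- pi..pi} f)\<^sup>2 / (2 * pi)
      = 2 * pi * (f t0 - integral {- pi..pi} f / (2 * pi))\<^sup>2"
    by (simp add: power2_eq_square field_simps)
  then have "0 \<le> 2 * pi * (f t0)\<^sup>2 - 2 * f t0 * integral {- pi..pi} f + (integral {- pi..pi} f)\<^sup>2 / (2 * pi)"
    by simp
  ultimately show ?thesis using le by linarith
qed

section \<open>Equality in the Wirtinger inequality\<close>

lemma integral_square_diff_mean: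
  assumes "L2 (- pi) pi f"
  shows "integral {- pi..pi} (\<lambda>t. (f t - integral {- pi..pi} f / (2 * pi))\<^sup>2)
    = integral {- pi..pi} (\<lambda>t. (f t)\<^sup>2) - (integral {- pi..pi} f)\<^sup>2 / (2 * pi)"
  using integral_square_lincomb[OF assms L2_continuous[of "- pi" pi "\<lambda>t. 1"], of 1 "- integral {- pi..pi} f / (2 * pi)"]
  by (simp add: field_simps power2_eq_square)

lemma integral_minus_mean:
  assumes "f integrable_on {- pi..pi}"
  shows "integral {- pi..pi} (\<lambda>t. f t - integral {- pi..pi} f / (2 * pi)) = 0"
proof -
  have "((\<lambda>t. f t - m) has_integral (integral {- pi..pi} f - 2 * pi * m)) {- pi..pi}" for m
    using has_integral_diff[OF integrable_integral[OF assms] has_integral_const_real[of m "- pi" pi]]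
    by simp
  from integral_unique[OF this[of "integral {- pi..pi} f / (2 * pi)"]] show ?thesis by simp
qed

text \<open>The vanishing mean of \<open>f\<close> makes its primitive periodic; the constant of
  integration is then spent on the mean of the primitive.\<close>

lemma H1p_mean_zero_primitive:
  assumes c: "continuous_on {- pi..pi} f" and z: "integral {- pi..pi} f = 0"
  obtains F where "H1p F f" "integral {- pi..pi} F = 0"
proof -
  define F0 where "F0 = (\<lambda>t. integral {- pi..t} f)"
  have F0: "H1p F0 f"
    unfolding F0_def
    by (rule H1p_C1) (use c z in \<open>auto intro!: integral_has_real_derivative\<close>)
  define m where "m = integral {- pi..pi} F0 / (2 * pi)"
  have "H1p (\<lambda>t. F0 t - m) f"
    using H1p_lincomb[OF F0 H1p_const[of 1], of 1 "- m"] by simp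
  moreover have "integral {- pi..pi} (\<lambda>t. F0 t - m) = 0"
    unfolding m_def
    by (intro integral_minus_mean integrable_continuous_real H1p_continuous_on[OF F0])
  ultimately show thesis by (rule that)
qed

lemma AC_zero_deriv:
  assumes "AC a b f f'" "\<And>t. t \<in> {a..b} \<Longrightarrow> f' t = 0" "t \<in> {a..b}"
  shows "f t = f a"
proof -
  have "(f' has_integral (f t - f a)) {a..t}"
    using assms(3) by (intro AC_has_integral[OF assms(1)]) auto
  moreover have "(f' has_integral 0) {a..t}"
    by (rule has_integral_is_0, rule assms(2)) (use assms(3) in simp)
  ultimately have "f t - f a = 0" by (rule has_integral_unique)
  then show ?thesis by simp
qed

text \<open>Rotating the pair (f, g) back by the angle t gives two conserved quantities, f cos + g
  sin and f sin - g cos; their values at \<open>a\<close> are the coefficients.\<close>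

lemma harmonic_oscillator:
  assumes f: "AC a b f (\<lambda>t. - g t)" and g: "AC a b g f"
  shows "\<exists>A B. \<forall>t\<in>{a..b}. f t = A * cos t + B * sin t"
proof -
  have c: "AC a b cos (\<lambda>t. - sin t)" and s: "AC a b sin cos"
    by (rule AC_C1; auto intro!: derivative_eq_intros continuous_intros)+
  have A: "f t * cos t + g t * sin t = f a * cos a + g a * sin a" if "t \<in> {a..b}" for t
    using AC_zero_deriv[OF AC_lincomb[OF AC_mult[OF f c] AC_mult[OF g s], of 1 1] _ that]
    by (simp add: algebra_simps)
  have B: "f t * sin t - g t * cos t = f a * sin a - g a * cos a" if "t \<in> {a..b}" for t
    using AC_zero_deriv[OF AC_lincomb[OF AC_mult[OF f s] AC_mult[OF g c], of 1 "-1"] _ that]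
    by (simp add: algebra_simps)
  show ?thesis
  proof (intro exI ballI)
    fix t assume t: "t \<in> {a..b}"
    have "f t = f t * ((sin t)\<^sup>2 + (cos t)\<^sup>2)" by simp
    also have "\<dots> = (f t * cos t + g t * sin t) * cos t + (f t * sin t - g t * cos t) * sin t"
      by algebra
    finally show "f t = (f a * cos a + g a * sin a) * cos t + (f a * sin a - g a * cos a) * sin t"
      using A[OF t] B[OF t] by simp
  qed
qed

lemma AC_cong_deriv:
  assumes f: "AC a b f f'" and g: "g' absolutely_integrable_on {a..b}"
    and N: "negligible N" "\<And>t. t \<in> {a..b} - N \<Longrightarrow> f' t = g' t"
  shows "AC a b f g'"
proof (rule AC_intro[OF g])
  fix t assume "t \<in> {a..b}"
  then show "(g' has_integral (f t - f a)) {a..t}"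
    by (intro has_integral_spike[OF N(1) _ AC_has_integral[OF f]]) (auto simp: N(2))
qed

text \<open>With \<open>F\<close> the mean-zero primitive of \<open>f\<close> minus its mean, the Wirtinger inequality for \<open>F\<close>
  bounds the integral of \<open>(f' + F)\<^sup>2\<close> by the defect of the inequality for \<open>f\<close>.\<close>
lemma Wirtinger_equality:
  assumes f: "H1p f f'"
    and eq: "integral {- pi..pi} (\<lambda>t. (f' t)\<^sup>2) =
         integral {- pi..pi} (\<lambda>t. (f t)\<^sup>2) - (integral {- pi..pi} f)\<^sup>2 / (2 * pi)"
  shows "\<exists>A B. \<forall>t\<in>{- pi..pi}. f t = integral {- pi..pi} f / (2 * pi) + A * cos t + B * sin t"
proof -
  define m where "m = integral {- pi..pi} f / (2 * pi)"
  define g where "g = (\<lambda>t. f t - m)"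
  have g: "H1p g f'"
    using H1p_lincomb[OF f H1p_const[of 1], of 1 "- m"] by (simp add: g_def)
  have cg: "continuous_on {- pi..pi} g" using g by (rule H1p_continuous_on)
  have "integral {- pi..pi} g = 0"
    unfolding m_def g_def
    by (intro integral_minus_mean integrable_continuous_real H1p_continuous_on[OF f])
  then obtain F where F: "H1p F g" "integral {- pi..pi} F = 0"
    using H1p_mean_zero_primitive[OF cg] by blast
  have gg: "integral {- pi..pi} (\<lambda>t. (g t)\<^sup>2) = integral {- pi..pi} (\<lambda>t. (f' t)\<^sup>2)"
    using integral_square_diff_mean[OF H1p_L2(1)[OF f]] eq by (simp add: g_def m_def)
  have L: "L2 (- pi) pi f'" "L2 (- pi) pi F" using H1p_L2 f F by auto
  have "integral {- pi..pi} (\<lambda>t. f' t * F t) = - integral {- pi..pi} (\<lambda>t. (g t)\<^sup>2)"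
    using H1p_by_parts[OF g F(1)] by (simp add: power2_eq_square)
  moreover have "integral {- pi..pi} (\<lambda>t. (f' t + F t)\<^sup>2) =
      integral {- pi..pi} (\<lambda>t. (f' t)\<^sup>2) + 2 * integral {- pi..pi} (\<lambda>t. f' t * F t)
       + integral {- pi..pi} (\<lambda>t. (F t)\<^sup>2)"
    using integral_square_lincomb[OF L, of 1 1] by simp
  moreover have "integral {- pi..pi} (\<lambda>t. (F t)\<^sup>2) \<le> integral {- pi..pi} (\<lambda>t. (g t)\<^sup>2)"
    using Wirtinger[OF F(1)] F(2) by simp
  ultimately have "integral {- pi..pi} (\<lambda>t. (f' t + F t)\<^sup>2) \<le> 0" using gg by linarith
  moreover have L2s: "L2 (- pi) pi (\<lambda>t. f' t + F t)" using L2_lincomb[OF L, of 1 1] by simp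
  then have "integral {- pi..pi} (\<lambda>t. (f' t + F t)\<^sup>2) \<ge> 0"
    by (intro integral_nonneg) (auto simp: L2_def)
  ultimately obtain N where N: "negligible N" "\<And>t. t \<in> {- pi..pi} - N \<Longrightarrow> f' t + F t = 0"
    using L2_square_zero[OF L2s] by (metis order_antisym)
  \<comment> \<open>Replacing the derivative by the continuous function -F, which equals it almost
    everywhere, closes the oscillator system g' = -F, F' = g.\<close>
  have "AC (- pi) pi g (\<lambda>t. - F t)"
  proof (rule AC_cong_deriv)
    show "AC (- pi) pi g f'" using g by (simp add: H1p_def)
    show "(\<lambda>t. - F t) absolutely_integrable_on {- pi..pi}"
      using H1p_continuous_on[OF F(1)] by (intro absolutely_integrable_continuous_real continuous_intros)
  qed (use N in \<open>auto simp: eq_neg_iff_add_eq_0\<close>)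
  moreover have "AC (- pi) pi F g" using F by (simp add: H1p_def)
  ultimately obtain A B where AB: "\<forall>t\<in>{- pi..pi}. g t = A * cos t + B * sin t"
    using harmonic_oscillator by blast
  show ?thesis
  proof (intro exI ballI)
    fix t assume "t \<in> {- pi..pi}"
    then have "g t = A * cos t + B * sin t" using AB by blast
    then show "f t = integral {- pi..pi} f / (2 * pi) + A * cos t + B * sin t"
      by (simp add: g_def m_def)
  qed
qed

section \<open>The planar functional\<close>

lemma integral_trig:
  shows "integral {- pi..pi} (\<lambda>t. m + p * cos t + q * sin t) = 2 * pi * m" (is ?A)
    and "integral {- pi..pi} (\<lambda>t. (m + p * cos t + q * sin t)\<^sup>2) = 2 * pi * m\<^sup>2 + pi * (p\<^sup>2 + q\<^sup>2)" (is ?B)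
proof -
  have "((\<lambda>t. m + p * cos t + q * sin t) has_integral
     ((\<lambda>t. m * t + p * sin t - q * cos t) pi - (\<lambda>t. m * t + p * sin t - q * cos t) (- pi))) {- pi..pi}"
    by (rule fundamental_theorem_of_calculus)
      (auto intro!: derivative_eq_intros simp flip: has_real_derivative_iff_has_vector_derivative)
  then show ?A by (simp add: integral_unique)
  let ?F = "\<lambda>t. m\<^sup>2 * t + p\<^sup>2 * (t + sin t * cos t) / 2 + q\<^sup>2 * (t - sin t * cos t) / 2
      + 2 * m * p * sin t - 2 * m * q * cos t + p * q * (sin t)\<^sup>2"
  have "((\<lambda>t. (m + p * cos t + q * sin t)\<^sup>2) has_integral (?F pi - ?F (- pi))) {- pi..pi}"
  proof (rule fundamental_theorem_of_calculus)
    fix t :: real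
    have e: "m\<^sup>2 + p\<^sup>2 * (1 + (cos t * cos t - sin t * sin t)) / 2 + q\<^sup>2 * (1 - (cos t * cos t - sin t * sin t)) / 2
        + 2 * m * p * cos t + 2 * m * q * sin t + p * q * (2 * sin t * cos t)
       = (m + p * cos t + q * sin t)\<^sup>2"
    proof -
      have "1 + (cos t * cos t - sin t * sin t) = 2 * (cos t)\<^sup>2"
        "1 - (cos t * cos t - sin t * sin t) = 2 * (sin t)\<^sup>2"
        using sin_cos_squared_add[of t] by (simp_all add: power2_eq_square)
      then show ?thesis by (simp only:) (simp add: power2_eq_square algebra_simps)
    qed
    have "(?F has_real_derivative (m\<^sup>2 + p\<^sup>2 * (1 + (cos t * cos t - sin t * sin t)) / 2
        + q\<^sup>2 * (1 - (cos t * cos t - sin t * sin t)) / 2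
        + 2 * m * p * cos t + 2 * m * q * sin t + p * q * (2 * sin t * cos t))) (at t within {- pi..pi})"
      by (auto intro!: derivative_eq_intros simp: field_simps)
    then show "(?F has_vector_derivative (m + p * cos t + q * sin t)\<^sup>2) (at t within {- pi..pi})"
      unfolding e has_real_derivative_iff_has_vector_derivative .
  qed simp
  then show ?B by (simp add: integral_unique algebra_simps)
qed

text \<open>Knowing \<open>f\<close> everywhere determines the chosen representative
  \<open>f'\<close> only up to a null set; this suffices for every integral in which it
  occurs.\<close>

lemma H1p_trig_deriv:
  assumes f: "H1p f f'" and eq: "\<And>t. t \<in> {- pi..pi} \<Longrightarrow> f t = m + p * cos t + q * sin t"
  obtains N where "negligible N" "\<And>t. t \<in> {- pi..pi} - N \<Longrightarrow> f' t = q * cos t - p * sin t"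
proof -
  have "AC (- pi) pi (\<lambda>t. m + p * cos t + q * sin t) (\<lambda>t. q * cos t - p * sin t)"
    by (rule AC_C1) (auto intro!: derivative_eq_intros continuous_intros)
  moreover have "AC (- pi) pi (\<lambda>t. m + p * cos t + q * sin t) f'"
  proof (rule AC_intro)
    have ac: "AC (- pi) pi f f'" using f by (simp add: H1p_def)
    show "f' absolutely_integrable_on {- pi..pi}" using ac by (rule AC_absint)
    fix t assume t: "t \<in> {- pi..pi}"
    have "(f' has_integral (f t - f (- pi))) {- pi..t}"
      using t by (intro AC_has_integral[OF ac]) auto
    then show "(f' has_integral (m + p * cos t + q * sin t - (m + p * cos (- pi) + q * sin (- pi)))) {- pi..t}"
      using eq[OF t] eq[of "- pi"] by simp
  qed
  ultimately obtain N where N: "negligible N" "\<And>t. t \<in> {- pi..pi} - N \<Longrightarrow> q * cos t - p * sin t = f' t"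
    by (rule AC_derivative_unique) blast
  show thesis by (rule that[OF N(1)]) (rule N(2)[symmetric])
qed

definition wirtinger_defect :: "(real \<Rightarrow> real) \<Rightarrow> (real \<Rightarrow> real) \<Rightarrow> real" where
  "wirtinger_defect f f' = integral {- pi..pi} (\<lambda>t. (f' t)\<^sup>2)
     - (integral {- pi..pi} (\<lambda>t. (f t)\<^sup>2) - (integral {- pi..pi} f)\<^sup>2 / (2 * pi))"

lemma wirtinger_defect_nonneg: "H1p f f' \<Longrightarrow> 0 \<le> wirtinger_defect f f'"
  using Wirtinger by (simp add: wirtinger_defect_def)

definition mean :: "(real \<Rightarrow> real) \<Rightarrow> real" where
  "mean f = integral {- pi..pi} f / (2 * pi)"

text \<open>The energy of \<open>a *\<^sub>R tauvec + b *\<^sub>R nvec\<close>: its derivative has coordinates \<open>a' + b\<close> and \<open>b' - a\<close>.\<close>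
definition planar :: "real \<Rightarrow> (real \<Rightarrow> real) \<Rightarrow> (real \<Rightarrow> real) \<Rightarrow> (real \<Rightarrow> real) \<Rightarrow> (real \<Rightarrow> real) \<Rightarrow> real" where
  "planar k a a' b b' = integral {- pi..pi} (\<lambda>t. (a' t + b t)\<^sup>2)
     + integral {- pi..pi} (\<lambda>t. (b' t - a t)\<^sup>2) + k * integral {- pi..pi} (\<lambda>t. (a t)\<^sup>2)"

text \<open>The functions a and b interact only through X, the integral of a' b: integration by
  parts gives -X for b' a, and subtracting means does not change either, since derivatives have mean
  zero. Everything thus becomes a linear expression in X, four square integrals and the squared
  means, and what remains is algebra.\<close>

lemma planar_decomposition:
  assumes a: "H1p a a'" and b: "H1p b b'" and PQ: "P * Q = 4" "P + Q > 0"
  shows "planar (P - Q) a a' b b'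
      - (2 - Q) * (integral {- pi..pi} (\<lambda>t. (a t)\<^sup>2) + integral {- pi..pi} (\<lambda>t. (b t)\<^sup>2))
    = (integral {- pi..pi} (\<lambda>t. (2 * a' t + Q * (b t - mean b))\<^sup>2)
        + integral {- pi..pi} (\<lambda>t. (P * (a t - mean a) - 2 * b' t)\<^sup>2)) / (P + Q)
      + (1 - 4 / (P + Q)) * (wirtinger_defect a a' + wirtinger_defect b b')
      + 2 * pi * ((P - 1) * (mean a)\<^sup>2 + (Q - 1) * (mean b)\<^sup>2)"
proof -
  let ?I = "integral {- pi..pi}"
  define A1 A2 B1 B2 X where "A1 = ?I (\<lambda>t. (a' t)\<^sup>2)" and "A2 = ?I (\<lambda>t. (a t)\<^sup>2)"
    and "B1 = ?I (\<lambda>t. (b' t)\<^sup>2)" and "B2 = ?I (\<lambda>t. (b t)\<^sup>2)" and "X = ?I (\<lambda>t. a' t * b t)"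
  have ta: "H1p (\<lambda>t. a t - mean a) a'" and tb: "H1p (\<lambda>t. b t - mean b) b'"
    using H1p_lincomb[OF a H1p_const[of 1], of 1 "- mean a"] H1p_lincomb[OF b H1p_const[of 1], of 1 "- mean b"]
    by simp_all
  note L = H1p_L2[OF a] H1p_L2[OF b] H1p_L2[OF ta] H1p_L2[OF tb]
  have sa: "?I (\<lambda>t. (a t - mean a)\<^sup>2) = A2 - 2 * pi * (mean a)\<^sup>2"
    and sb: "?I (\<lambda>t. (b t - mean b)\<^sup>2) = B2 - 2 * pi * (mean b)\<^sup>2"
    using integral_square_diff_mean[OF L(1)] integral_square_diff_mean[OF L(3)]
    by (simp_all add: A2_def B2_def mean_def power2_eq_square)
  have wa: "wirtinger_defect a a' = A1 - (A2 - 2 * pi * (mean a)\<^sup>2)" and wb: "wirtinger_defect b b' = B1 - (B2 - 2 * pi * (mean b)\<^sup>2)"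
    by (simp_all add: wirtinger_defect_def A1_def A2_def B1_def B2_def mean_def power2_eq_square)
  have Y: "?I (\<lambda>t. b' t * a t) = - X"
    using H1p_by_parts[OF b a] by (simp add: X_def mult.commute)
  have "?I (\<lambda>t. a' t * (b t - mean b)) = ?I (\<lambda>t. a' t * b t - mean b * a' t)"
    by (simp add: algebra_simps)
  also have "\<dots> = X - mean b * 0"
    unfolding X_def
    by (intro integral_unique has_integral_diff has_integral_mult_right integrable_integral
        L2_mult_integrable H1p_integral_deriv[OF a] L)
  finally have Xb: "?I (\<lambda>t. a' t * (b t - mean b)) = X" by simp
  then have Ya: "?I (\<lambda>t. (a t - mean a) * b' t) = - X"
  proof -
    have "?I (\<lambda>t. b' t * (a t - mean a)) = ?I (\<lambda>t. b' t * a t - mean a * b' t)"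
      by (simp add: algebra_simps)
    also have "\<dots> = - X - mean a * 0"
      unfolding Y[symmetric]
      by (intro integral_unique has_integral_diff has_integral_mult_right integrable_integral
          L2_mult_integrable H1p_integral_deriv[OF b] L)
    finally show ?thesis by (simp add: mult.commute)
  qed
  have e1: "?I (\<lambda>t. (a' t + b t)\<^sup>2) = A1 + 2 * X + B2"
    using integral_square_lincomb[OF L(2) L(3), of 1 1] by (simp add: A1_def B2_def X_def)
  have e2: "?I (\<lambda>t. (b' t - a t)\<^sup>2) = B1 + 2 * X + A2"
    using integral_square_lincomb[OF L(4) L(1), of 1 "-1"] by (simp add: B1_def A2_def Y)
  have e3: "?I (\<lambda>t. (2 * a' t + Q * (b t - mean b))\<^sup>2) = 4 * A1 + 4 * Q * X + Q\<^sup>2 * (B2 - 2 * pi * (mean b)\<^sup>2)"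
    using integral_square_lincomb[OF L(2) L(7), of 2 Q] by (simp add: A1_def sb Xb)
  have e4: "?I (\<lambda>t. (P * (a t - mean a) - 2 * b' t)\<^sup>2) = P\<^sup>2 * (A2 - 2 * pi * (mean a)\<^sup>2) + 4 * P * X + 4 * B1"
    using integral_square_lincomb[OF L(5) L(8), of P "-2"] by (simp add: B1_def sa Ya)
  \<comment> \<open>From P Q = 4 follow P^2 = P w - 4 and Q^2 = Q w - 4: division by w reproduces
    the coefficients P and Q exactly, and the leftover 4 / w is what the Wirtinger defects
    absorb.\<close>
  define w where "w = P + Q"
  have w: "w \<noteq> 0" "P\<^sup>2 = P * w - 4" "Q\<^sup>2 = Q * w - 4"
    using PQ by (auto simp: w_def power2_eq_square algebra_simps)
  have "(4 * A1 + 4 * Q * X + Q\<^sup>2 * (B2 - 2 * pi * (mean b)\<^sup>2)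
        + (P\<^sup>2 * (A2 - 2 * pi * (mean a)\<^sup>2) + 4 * P * X + 4 * B1)) / w
    = 4 * X + Q * (B2 - 2 * pi * (mean b)\<^sup>2) + P * (A2 - 2 * pi * (mean a)\<^sup>2)
      + (4 / w) * (A1 + B1 - (B2 - 2 * pi * (mean b)\<^sup>2) - (A2 - 2 * pi * (mean a)\<^sup>2))"
  proof -
    have "4 * Q * X + 4 * P * X = w * (4 * X)" by (simp add: w_def algebra_simps)
    then show ?thesis unfolding w(2,3) using w(1) by (simp add: field_simps)
  qed
  then show ?thesis
    unfolding planar_def e1 e2 e3 e4 wa wb A2_def[symmetric] B2_def[symmetric] w_def[symmetric]
    by (simp add: algebra_simps)
qed

text \<open>The gap is a sum of nonnegative terms, so it vanishes only if each does. The strict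
  bounds \<open>P + Q > 4\<close> and \<open>P > 1\<close> make the defects and the mean of a
  visible in the gap, while \<open>Q = 1\<close> leaves the mean of b free.\<close>

lemma planar_nonneg:
  assumes a: "H1p a a'" and b: "H1p b b'" and PQ: "P * Q = 4" "P + Q > 4" "P > 1" "Q \<ge> 1"
  shows "(2 - Q) * (integral {- pi..pi} (\<lambda>t. (a t)\<^sup>2) + integral {- pi..pi} (\<lambda>t. (b t)\<^sup>2))
           \<le> planar (P - Q) a a' b b'" (is ?nonneg)
    and "planar (P - Q) a a' b b' =
           (2 - Q) * (integral {- pi..pi} (\<lambda>t. (a t)\<^sup>2) + integral {- pi..pi} (\<lambda>t. (b t)\<^sup>2)) \<longleftrightarrow>
         integral {- pi..pi} (\<lambda>t. (2 * a' t + Q * (b t - mean b))\<^sup>2) = 0 \<and>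
         integral {- pi..pi} (\<lambda>t. (P * (a t - mean a) - 2 * b' t)\<^sup>2) = 0 \<and>
         wirtinger_defect a a' = 0 \<and> wirtinger_defect b b' = 0 \<and> mean a = 0 \<and> (Q - 1) * mean b = 0" (is ?eq)
proof -
  have ta: "H1p (\<lambda>t. a t - mean a) a'" and tb: "H1p (\<lambda>t. b t - mean b) b'"
    using H1p_lincomb[OF a H1p_const[of 1], of 1 "- mean a"] H1p_lincomb[OF b H1p_const[of 1], of 1 "- mean b"]
    by simp_all
  let ?S = "integral {- pi..pi} (\<lambda>t. (2 * a' t + Q * (b t - mean b))\<^sup>2)"
  let ?T = "integral {- pi..pi} (\<lambda>t. (P * (a t - mean a) - 2 * b' t)\<^sup>2)"
  have S: "?S \<ge> 0"
    using L2_lincomb[OF H1p_L2(2)[OF a] H1p_L2(1)[OF tb], of 2 Q]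
    by (intro integral_nonneg) (auto simp: L2_def)
  have T: "?T \<ge> 0"
    using L2_lincomb[OF H1p_L2(1)[OF ta] H1p_L2(2)[OF b], of P "-2"]
    by (intro integral_nonneg) (auto simp: L2_def)
  define x where "x = (?S + ?T) / (P + Q)"
  define y where "y = (1 - 4 / (P + Q)) * (wirtinger_defect a a' + wirtinger_defect b b')"
  define z where "z = 2 * pi * ((P - 1) * (mean a)\<^sup>2)"
  define v where "v = 2 * pi * ((Q - 1) * (mean b)\<^sup>2)"
  have dec: "planar (P - Q) a a' b b'
      - (2 - Q) * (integral {- pi..pi} (\<lambda>t. (a t)\<^sup>2) + integral {- pi..pi} (\<lambda>t. (b t)\<^sup>2)) = x + y + z + v"
    using planar_decomposition[OF a b PQ(1)] PQ(2) by (simp add: x_def y_def z_def v_def algebra_simps)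
  have w: "1 - 4 / (P + Q) > 0" "P + Q > 0" using PQ(2) by auto
  have nn: "x \<ge> 0" "y \<ge> 0" "z \<ge> 0" "v \<ge> 0"
    using S T w wirtinger_defect_nonneg[OF a] wirtinger_defect_nonneg[OF b] PQ(3,4) by (auto simp: x_def y_def z_def v_def)
  then show ?nonneg using dec by linarith
  have "x = 0 \<longleftrightarrow> ?S = 0 \<and> ?T = 0"
    using S T w by (auto simp: x_def add_nonneg_eq_0_iff)
  moreover have "y = 0 \<longleftrightarrow> wirtinger_defect a a' = 0 \<and> wirtinger_defect b b' = 0"
    using wirtinger_defect_nonneg[OF a] wirtinger_defect_nonneg[OF b] w by (auto simp: y_def add_nonneg_eq_0_iff)
  moreover have "z = 0 \<longleftrightarrow> mean a = 0" using PQ(3) by (simp add: z_def)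
  moreover have "v = 0 \<longleftrightarrow> (Q - 1) * mean b = 0" by (simp add: v_def)
  moreover have "planar (P - Q) a a' b b' =
           (2 - Q) * (integral {- pi..pi} (\<lambda>t. (a t)\<^sup>2) + integral {- pi..pi} (\<lambda>t. (b t)\<^sup>2))
     \<longleftrightarrow> x = 0 \<and> y = 0 \<and> z = 0 \<and> v = 0"
    using dec nn by linarith
  ultimately show ?eq by blast
qed

lemma wirtinger_defect_trig_zero:
  assumes f: "H1p f f'" and eq: "\<And>t. t \<in> {- pi..pi} \<Longrightarrow> f t = m + p * cos t + q * sin t"
  shows "wirtinger_defect f f' = 0" "mean f = m" "integral {- pi..pi} (\<lambda>t. (f t)\<^sup>2) = 2 * pi * m\<^sup>2 + pi * (p\<^sup>2 + q\<^sup>2)"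
proof -
  obtain N where N: "negligible N" "\<And>t. t \<in> {- pi..pi} - N \<Longrightarrow> f' t = q * cos t - p * sin t"
    using H1p_trig_deriv[OF f eq] by blast
  have "integral {- pi..pi} (\<lambda>t. (f' t)\<^sup>2) = integral {- pi..pi} (\<lambda>t. (0 + q * cos t + (- p) * sin t)\<^sup>2)"
    by (rule integral_spike[OF N(1)]) (simp add: N(2))
  then have d: "integral {- pi..pi} (\<lambda>t. (f' t)\<^sup>2) = pi * (p\<^sup>2 + q\<^sup>2)"
    unfolding integral_trig(2) by simp
  have i: "integral {- pi..pi} f = 2 * pi * m"
    using integral_cong[of "{- pi..pi}" f, OF eq] integral_trig(1) by simp
  show s: "integral {- pi..pi} (\<lambda>t. (f t)\<^sup>2) = 2 * pi * m\<^sup>2 + pi * (p\<^sup>2 + q\<^sup>2)"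
    using integral_cong[of "{- pi..pi}" "\<lambda>t. (f t)\<^sup>2" "\<lambda>t. (m + p * cos t + q * sin t)\<^sup>2"] eq
    by (simp add: integral_trig(2))
  show "wirtinger_defect f f' = 0" unfolding wirtinger_defect_def d i s by (simp add: power2_eq_square)
  show "mean f = m" unfolding mean_def i by simp
qed

text \<open>Vanishing defects make a and b trigonometric polynomials of degree one; the first square
  then expresses the coefficients of b through those of a, and \<open>m\<close> is the mean of
  b.\<close>

lemma planar_equality_iff:
  assumes a: "H1p a a'" and b: "H1p b b'" and PQ: "P * Q = 4" "P + Q > 4" "P > 1" "Q \<ge> 1"
  shows "planar (P - Q) a a' b b' =
           (2 - Q) * (integral {- pi..pi} (\<lambda>t. (a t)\<^sup>2) + integral {- pi..pi} (\<lambda>t. (b t)\<^sup>2)) \<longleftrightarrow>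
     (\<exists>p q m. (Q - 1) * m = 0 \<and> (\<forall>t\<in>{- pi..pi}. a t = p * cos t + q * sin t
        \<and> b t = m + (2 / Q) * (p * sin t - q * cos t)))" (is "?L \<longleftrightarrow> ?R")
proof
  assume ?L
  then have z: "integral {- pi..pi} (\<lambda>t. (2 * a' t + Q * (b t - mean b))\<^sup>2) = 0"
    "wirtinger_defect a a' = 0" "wirtinger_defect b b' = 0" "mean a = 0" "(Q - 1) * mean b = 0"
    using planar_nonneg(2)[OF a b PQ] by auto
  have "\<exists>A B. \<forall>t\<in>{- pi..pi}. a t = mean a + A * cos t + B * sin t"
    "\<exists>A B. \<forall>t\<in>{- pi..pi}. b t = mean b + A * cos t + B * sin t"
    unfolding mean_def using z(2,3)
    by (auto intro!: Wirtinger_equality[OF a] Wirtinger_equality[OF b] simp: wirtinger_defect_def)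
  then obtain p q r s where ab: "\<And>t. t \<in> {- pi..pi} \<Longrightarrow> a t = p * cos t + q * sin t"
    "\<And>t. t \<in> {- pi..pi} \<Longrightarrow> b t = mean b + r * cos t + s * sin t"
    using z(4) by force
  have tb: "H1p (\<lambda>t. b t - mean b) b'"
    using H1p_lincomb[OF b H1p_const[of 1], of 1 "- mean b"] by simp
  obtain N where N: "negligible N" "\<And>t. t \<in> {- pi..pi} - N \<Longrightarrow> 2 * a' t + Q * (b t - mean b) = 0"
    using L2_square_zero[OF L2_lincomb[OF H1p_L2(2)[OF a] H1p_L2(1)[OF tb], of 2 Q] z(1)] by blast
  obtain M where M: "negligible M" "\<And>t. t \<in> {- pi..pi} - M \<Longrightarrow> a' t = q * cos t - p * sin t"
    using H1p_trig_deriv[OF a, of 0 p q] ab(1) by auto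
  \<comment> \<open>Integrating the square turns an identity valid almost everywhere into an
    identity between coefficients.\<close>
  have "integral {- pi..pi} (\<lambda>t. (0 + (2 * q + Q * r) * cos t + (Q * s - 2 * p) * sin t)\<^sup>2)
      = integral {- pi..pi} (\<lambda>t. 0)"
  proof (rule integral_spike)
    show "negligible (N \<union> M)" using N M by simp
    fix t assume t: "t \<in> {- pi..pi} - (N \<union> M)"
    then have "2 * (q * cos t - p * sin t) + Q * (r * cos t + s * sin t) = 0"
      using N(2)[of t] M(2)[of t] ab(2)[of t] by simp
    then show "0 = (0 + (2 * q + Q * r) * cos t + (Q * s - 2 * p) * sin t)\<^sup>2"
      by (simp add: algebra_simps)
  qed
  then have "(2 * q + Q * r)\<^sup>2 + (Q * s - 2 * p)\<^sup>2 = 0"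
    unfolding integral_trig by simp
  then have "2 * q + Q * r = 0" "Q * s - 2 * p = 0"
    by (simp_all add: sum_power2_eq_zero_iff)
  then have rs: "r = - (2 / Q) * q" "s = (2 / Q) * p" using PQ(4) by (auto simp: field_simps)
  show ?R
  proof (intro exI conjI ballI)
    fix t assume t: "t \<in> {- pi..pi}"
    show "a t = p * cos t + q * sin t" using ab(1)[OF t] .
    show "b t = mean b + (2 / Q) * (p * sin t - q * cos t)"
      using ab(2)[OF t] rs by (simp add: algebra_simps)
  qed (rule z(5))
next
  assume ?R
  then obtain p q m where m: "(Q - 1) * m = 0" and
    ab: "\<forall>t\<in>{- pi..pi}. a t = p * cos t + q * sin t \<and> b t = m + (2 / Q) * (p * sin t - q * cos t)"
    by blast
  have at: "a t = 0 + p * cos t + q * sin t"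
    and bt: "b t = m + (- (2 / Q) * q) * cos t + ((2 / Q) * p) * sin t" if "t \<in> {- pi..pi}" for t
    using bspec[OF ab that] by (simp_all add: algebra_simps)
  have ma: "mean a = 0" and mb: "mean b = m" and w: "wirtinger_defect a a' = 0" "wirtinger_defect b b' = 0"
    using wirtinger_defect_trig_zero[OF a at] wirtinger_defect_trig_zero[OF b bt] by auto
  obtain N where N: "negligible N" "\<And>t. t \<in> {- pi..pi} - N \<Longrightarrow> a' t = q * cos t - p * sin t"
    using H1p_trig_deriv[OF a at] by blast
  obtain M where M: "negligible M" "\<And>t. t \<in> {- pi..pi} - M \<Longrightarrow>
      b' t = ((2 / Q) * p) * cos t - (- (2 / Q) * q) * sin t"
    using H1p_trig_deriv[OF b bt] by blast
  have "integral {- pi..pi} (\<lambda>t. (2 * a' t + Q * (b t - mean b))\<^sup>2) = integral {- pi..pi} (\<lambda>t. 0)"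
  proof (rule integral_spike[OF N(1)])
    fix t assume "t \<in> {- pi..pi} - N"
    then have "2 * a' t + Q * (b t - mean b) = 0"
      using N(2)[of t] bt[of t] mb PQ(4) by (simp add: field_simps)
    then show "0 = (2 * a' t + Q * (b t - mean b))\<^sup>2" by simp
  qed
  moreover have "integral {- pi..pi} (\<lambda>t. (P * (a t - mean a) - 2 * b' t)\<^sup>2) = integral {- pi..pi} (\<lambda>t. 0)"
  proof (rule integral_spike[OF M(1)])
    fix t assume t: "t \<in> {- pi..pi} - M"
    \<comment> \<open>Here b' = (2 / Q) a almost everywhere, so P Q = 4 makes the second square
      vanish for the same coefficients as the first.\<close>
    have P: "P = 4 / Q" using PQ by (simp add: field_simps)
    have "P * (a t - mean a) - 2 * b' t = 0"
      using M(2)[OF t] at[of t] t ma unfolding P by (simp add: algebra_simps add_divide_distrib)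
    then show "0 = (P * (a t - mean a) - 2 * b' t)\<^sup>2" by simp
  qed
  ultimately show ?L
    using planar_nonneg(2)[OF a b PQ] ma mb w m by simp
qed

section \<open>Reduction to scalar functions in the moving frame\<close>

lemma vec3_frame:
  fixes v :: "real^3"
  shows "v = x *\<^sub>R tauvec t + y *\<^sub>R nvec t \<longleftrightarrow>
     v $ 3 = 0 \<and> - (v $ 1) * sin t + v $ 2 * cos t = x \<and> v $ 1 * cos t + v $ 2 * sin t = y"
proof -
  have "v = x *\<^sub>R tauvec t + y *\<^sub>R nvec t \<longleftrightarrow>
     v $ 1 = - x * sin t + y * cos t \<and> v $ 2 = x * cos t + y * sin t \<and> v $ 3 = 0"
    by (simp add: vec_eq_iff forall_3 tauvec_def nvec_def)
  moreover have "v $ 1 = - x * sin t + y * cos t \<and> v $ 2 = x * cos t + y * sin t \<longleftrightarrow>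
     - (v $ 1) * sin t + v $ 2 * cos t = x \<and> v $ 1 * cos t + v $ 2 * sin t = y"
    using sin_cos_squared_add[of t] unfolding power2_eq_square by algebra
  ultimately show ?thesis by blast
qed

definition tcoord :: "(real \<Rightarrow> real^3) \<Rightarrow> real \<Rightarrow> real" where
  "tcoord u t = - (u t $ 1) * sin t + u t $ 2 * cos t"

definition ncoord :: "(real \<Rightarrow> real^3) \<Rightarrow> real \<Rightarrow> real" where
  "ncoord u t = u t $ 1 * cos t + u t $ 2 * sin t"

lemma norm_vec3: "(norm (v :: real^3))\<^sup>2 = (v $ 1)\<^sup>2 + (v $ 2)\<^sup>2 + (v $ 3)\<^sup>2"
  by (simp add: power2_norm_eq_inner inner_vec_def sum_3 flip: power2_eq_square)

lemma norm_frame: "(norm (u t :: real^3))\<^sup>2 = (tcoord u t)\<^sup>2 + (ncoord u t)\<^sup>2 + (u t $ 3)\<^sup>2"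
  unfolding norm_vec3 tcoord_def ncoord_def
  using sin_cos_squared_add[of t] unfolding power2_eq_square by algebra

lemma norm_cross_nvec: "(norm (cross3 (u t) (nvec t)))\<^sup>2 = (tcoord u t)\<^sup>2 + (u t $ 3)\<^sup>2"
  unfolding norm_vec3 tcoord_def nvec_def cross3_def
  using sin_cos_squared_add[of t] by (simp add: power2_eq_square) algebra

text \<open>Absolute integrability of \<open>g\<close> provides measurability of the component; its
  square is then dominated by the squared norm.\<close>

lemma H1_per_component:
  assumes "H1_per u g"
  shows "H1p (\<lambda>t. u t $ i) (\<lambda>t. g t $ i)"
proof -
  have ai: "g absolutely_integrable_on {- pi..pi}" and n: "(\<lambda>t. (norm (g t))\<^sup>2) integrable_on {- pi..pi}"
    and u: "\<And>t. t \<in> {- pi..pi} \<Longrightarrow> u t = u (- pi) + integral {- pi..t} g" and per: "u pi = u (- pi)"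
    using assms unfolding H1_per_def by blast+
  have ci: "(\<lambda>t. g t $ i) absolutely_integrable_on {- pi..pi}"
    using absolutely_integrable_component[OF ai, of "axis i 1"] by (simp add: inner_axis)
  have "AC (- pi) pi (\<lambda>t. u t $ i) (\<lambda>t. g t $ i)"
  proof (rule AC_intro[OF ci])
    fix t assume t: "t \<in> {- pi..pi}"
    have "g integrable_on {- pi..pi}"
      using ai by (simp add: absolutely_integrable_on_def)
    then have "g integrable_on {- pi..t}"
      by (rule integrable_subinterval_real) (use t in auto)
    then have "(g has_integral (u t - u (- pi))) {- pi..t}"
      unfolding has_integral_iff using u[OF t] by simp
    from has_integral_linear[OF this bounded_linear_vec_nth[of i]]
    show "((\<lambda>t. g t $ i) has_integral (u t $ i - u (- pi) $ i)) {- pi..t}"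
      by (simp add: o_def)
  qed
  moreover have "L2 (- pi) pi (\<lambda>t. g t $ i)"
    unfolding L2_def
  proof
    show m: "(\<lambda>t. g t $ i) \<in> borel_measurable (lebesgue_on {- pi..pi})"
      by (rule absolutely_integrable_imp_borel_measurable[OF ci]) simp
    have "(\<lambda>t. (g t $ i)\<^sup>2) absolutely_integrable_on {- pi..pi}"
    proof (rule measurable_bounded_by_integrable_imp_absolutely_integrable[OF _ _ n])
      show "(\<lambda>t. (g t $ i)\<^sup>2) \<in> borel_measurable (lebesgue_on {- pi..pi})"
        using m by (rule borel_measurable_power)
      show "norm ((g t $ i)\<^sup>2) \<le> (norm (g t))\<^sup>2" for t
        using component_le_norm_cart[of "g t" i] power_mono[of "\<bar>g t $ i\<bar>" "norm (g t)" 2] by simp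
    qed simp
    then show "(\<lambda>t. (g t $ i)\<^sup>2) integrable_on {- pi..pi}" by (rule absint_integrable)
  qed
  ultimately show ?thesis using per by (simp add: H1p_def)
qed

lemma H1p_mult_smooth:
  assumes f: "H1p f f'" and s: "\<And>t. (s has_real_derivative s' t) (at t)"
    and cs: "continuous_on {- pi..pi} s'" and per: "s pi = s (- pi)"
  shows "H1p (\<lambda>t. f t * s t) (\<lambda>t. f' t * s t + f t * s' t)"
proof -
  have H: "H1p s s'" by (rule H1p_C1[OF has_field_derivative_at_within[OF s] cs per])
  have "L2 (- pi) pi (\<lambda>t. s t * f' t)" "L2 (- pi) pi (\<lambda>t. f t * s' t)"
    using f H cs by (auto intro: L2_mult_continuous L2_continuous H1p_continuous_on H1p_L2)
  then have "L2 (- pi) pi (\<lambda>t. f' t * s t + f t * s' t)"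
    using L2_lincomb[of "- pi" pi "\<lambda>t. s t * f' t" "\<lambda>t. f t * s' t" 1 1] by (simp add: mult.commute)
  then show ?thesis
    using AC_mult[of "- pi" pi f f' s s'] f H by (simp add: H1p_def)
qed

text \<open>Product rule with tau' = -n and n' = tau. Note that \<open>tcoord g\<close> is the
  tangential coordinate of the derivative, not the derivative of \<open>tcoord u\<close>; the
  rotation of the frame accounts for the difference and couples the two coordinates.\<close>

lemma H1_per_frame:
  assumes "H1_per u g"
  shows "H1p (tcoord u) (\<lambda>t. tcoord g t - ncoord u t)"
    and "H1p (ncoord u) (\<lambda>t. ncoord g t + tcoord u t)"
proof -
  note c = H1_per_component[OF assms]
  have s: "H1p (\<lambda>t. u t $ i * sin t) (\<lambda>t. g t $ i * sin t + u t $ i * cos t)" for i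
    by (rule H1p_mult_smooth[OF c]) (auto intro!: derivative_eq_intros continuous_intros)
  have k: "H1p (\<lambda>t. u t $ i * cos t) (\<lambda>t. g t $ i * cos t + u t $ i * (- sin t))" for i
    by (rule H1p_mult_smooth[OF c]) (auto intro!: derivative_eq_intros continuous_intros)
  have "tcoord u = (\<lambda>t. - 1 * (u t $ 1 * sin t) + 1 * (u t $ 2 * cos t))"
    "(\<lambda>t. tcoord g t - ncoord u t) = (\<lambda>t. - 1 * (g t $ 1 * sin t + u t $ 1 * cos t)
        + 1 * (g t $ 2 * cos t + u t $ 2 * (- sin t)))"
    by (auto simp: tcoord_def ncoord_def fun_eq_iff)
  then show "H1p (tcoord u) (\<lambda>t. tcoord g t - ncoord u t)"
    using H1p_lincomb[OF s[of 1] k[of 2], of "- 1" 1] by (simp only:)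
  have "ncoord u = (\<lambda>t. 1 * (u t $ 2 * sin t) + 1 * (u t $ 1 * cos t))"
    "(\<lambda>t. ncoord g t + tcoord u t) = (\<lambda>t. 1 * (g t $ 2 * sin t + u t $ 2 * cos t)
        + 1 * (g t $ 1 * cos t + u t $ 1 * (- sin t)))"
    by (auto simp: tcoord_def ncoord_def fun_eq_iff)
  then show "H1p (ncoord u) (\<lambda>t. ncoord g t + tcoord u t)"
    using H1p_lincomb[OF s[of 2] k[of 1], of 1 1] by (simp only:)
qed

lemma H1p_square_integrable: "H1p f f' \<Longrightarrow> (\<lambda>t. (f t)\<^sup>2) integrable_on {- pi..pi}"
  using H1p_L2(1) by (auto simp: L2_def)

lemma L2sq_frame:
  assumes "H1_per u g"
  shows "L2sq u = integral {- pi..pi} (\<lambda>t. (tcoord u t)\<^sup>2) + integral {- pi..pi} (\<lambda>t. (ncoord u t)\<^sup>2)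
     + integral {- pi..pi} (\<lambda>t. (u t $ 3)\<^sup>2)"
  unfolding L2sq_def norm_frame
  by (intro integral_unique has_integral_add integrable_integral
      H1p_square_integrable[OF H1_per_frame(1)[OF assms]] H1p_square_integrable[OF H1_per_frame(2)[OF assms]]
      H1p_square_integrable[OF H1_per_component[OF assms]])

lemma energy_frame:
  assumes "H1_per u g"
  shows "energy k u g = planar k (tcoord u) (\<lambda>t. tcoord g t - ncoord u t) (ncoord u) (\<lambda>t. ncoord g t + tcoord u t)
     + integral {- pi..pi} (\<lambda>t. (g t $ 3)\<^sup>2) + k * integral {- pi..pi} (\<lambda>t. (u t $ 3)\<^sup>2)"
proof -
  note H = H1_per_frame[OF assms] H1_per_component[OF assms, of 3]
  have t: "L2 (- pi) pi (tcoord g)" and n: "L2 (- pi) pi (ncoord g)"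
    using L2_lincomb[OF H1p_L2(2)[OF H(1)] H1p_L2(1)[OF H(2)], of 1 1]
      L2_lincomb[OF H1p_L2(2)[OF H(2)] H1p_L2(1)[OF H(1)], of 1 "- 1"] by simp_all
  have "integral {- pi..pi} (\<lambda>t. (norm (g t))\<^sup>2) = integral {- pi..pi} (\<lambda>t. (tcoord g t)\<^sup>2)
     + integral {- pi..pi} (\<lambda>t. (ncoord g t)\<^sup>2) + integral {- pi..pi} (\<lambda>t. (g t $ 3)\<^sup>2)"
    unfolding norm_frame using t n H1p_L2(2)[OF H(3)]
    by (intro integral_unique has_integral_add integrable_integral) (auto simp: L2_def)
  moreover have "integral {- pi..pi} (\<lambda>t. (norm (cross3 (u t) (nvec t)))\<^sup>2)
     = integral {- pi..pi} (\<lambda>t. (tcoord u t)\<^sup>2) + integral {- pi..pi} (\<lambda>t. (u t $ 3)\<^sup>2)"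
    unfolding norm_cross_nvec
    by (intro integral_unique has_integral_add integrable_integral
        H(1,3)[THEN H1p_square_integrable])
  ultimately show ?thesis
    by (simp add: energy_def planar_def algebra_simps)
qed

lemma H1p_square_zero:
  assumes "H1p f f'" "integral {- pi..pi} (\<lambda>t. (f t)\<^sup>2) = 0" "t \<in> {- pi..pi}"
  shows "f t = 0"
proof -
  have "continuous_on {- pi..pi} (\<lambda>t. (f t)\<^sup>2)"
    using H1p_continuous_on[OF assms(1)] by (intro continuous_intros)
  then show ?thesis
    using integral_eq_0_iff[of "- pi" pi "\<lambda>t. (f t)\<^sup>2"] assms(2,3) by simp
qed

section \<open>The sharp constant and the equality cases\<close>

text \<open>The quantities \<open>P\<close> and \<open>Q\<close> of the decomposition, taken at \<open>min k 3\<close> because the best constant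
  is frozen from \<open>k = 3\<close> on.\<close>
definition eigP :: "real \<Rightarrow> real" where
  "eigP k = (omega2 (min k 3) + min k 3) / 2"

definition eigQ :: "real \<Rightarrow> real" where
  "eigQ k = (omega2 (min k 3) - min k 3) / 2"

lemma eig_facts:
  assumes "k > 0"
  shows "eigP k * eigQ k = 4" "eigP k + eigQ k > 4" "eigP k > 2" "eigQ k \<ge> 1" "eigQ k < 2"
    "eigP k - eigQ k = min k 3" "c2 k = 2 - eigQ k" "k \<ge> 3 \<Longrightarrow> eigQ k = 1" "k < 3 \<Longrightarrow> eigQ k > 1"
proof -
  define j where "j = min k 3"
  define w where "w = omega2 j"
  have PQ_def: "eigP k = (w + j) / 2" "eigQ k = (w - j) / 2"
    by (simp_all add: eigP_def eigQ_def w_def j_def)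
  have j: "0 < j" "j \<le> 3" using assms by (auto simp: j_def)
  have w2: "w\<^sup>2 = j\<^sup>2 + 16" and w0: "w \<ge> 0" by (simp_all add: w_def omega2_def)
  show "eigP k - eigQ k = min k 3" unfolding j_def[symmetric] PQ_def by (simp add: field_simps)
  have "eigP k * eigQ k = (w\<^sup>2 - j\<^sup>2) / 4"
    unfolding PQ_def by (simp add: field_simps power2_eq_square)
  then show PQ: "eigP k * eigQ k = 4" using w2 by simp
  have w4: "w > 4"
  proof (rule power2_less_imp_less)
    have "j\<^sup>2 > 0" using j(1) by (simp only: zero_less_power)
    then show "4\<^sup>2 < w\<^sup>2" unfolding w2 by simp
  qed (rule w0)
  show "eigP k + eigQ k > 4" using w4 unfolding PQ_def by (simp add: field_simps)
  show P: "eigP k > 2" using w4 j(1) unfolding PQ_def by (simp add: field_simps)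
  show "eigQ k < 2"
  proof (rule ccontr)
    assume "\<not> eigQ k < 2"
    then have "2 * 2 < eigP k * eigQ k" using P by (intro mult_less_le_imp_less) auto
    then show False using PQ by simp
  qed
  show Q1: "eigQ k \<ge> 1"
  proof -
    \<comment> \<open>Expanded, this says 4 j <= 12: the origin of the threshold 3.\<close>
    have "(j + 2)\<^sup>2 \<le> w\<^sup>2" using j unfolding w2 by (simp add: power2_sum)
    then have "j + 2 \<le> w" using w0 by (rule power2_le_imp_le)
    then show ?thesis unfolding PQ_def by (simp add: field_simps)
  qed
  show "k < 3 \<Longrightarrow> eigQ k > 1"
  proof -
    assume "k < 3"
    then have "j < 3" by (simp add: j_def)
    then have "(j + 2)\<^sup>2 < w\<^sup>2" using j unfolding w2 by (simp add: power2_sum)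
    then have "j + 2 < w" using w0 by (rule power2_less_imp_less)
    then show ?thesis unfolding PQ_def by (simp add: field_simps)
  qed
  have "omega2 3 = 5" by (simp add: omega2_def real_sqrt_unique)
  then show Q3: "k \<ge> 3 \<Longrightarrow> eigQ k = 1" by (simp add: eigQ_def)
  show "c2 k = 2 - eigQ k"
    using Q3 by (auto simp: c2_def eigQ_def field_simps min_def)
qed

text \<open>The gap is split into four nonnegative parts: E is the planar gap at
  \<open>min k 3\<close>, A the cost of the excess of k over 3, and D and C belong to the third
  component.\<close>

lemma energy_c2_bound:
  assumes k: "k > 0" and H: "H1_per u g"
  shows "c2 k * L2sq u \<le> energy k u g" (is ?le)
    and "energy k u g = c2 k * L2sq u \<longleftrightarrow>
      (\<forall>t\<in>{- pi..pi}. u t $ 3 = 0) \<and>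
      (\<exists>p q m. (eigQ k - 1) * m = 0 \<and> (k > 3 \<longrightarrow> p = 0 \<and> q = 0) \<and>
        (\<forall>t\<in>{- pi..pi}. tcoord u t = p * cos t + q * sin t
           \<and> ncoord u t = m + (2 / eigQ k) * (p * sin t - q * cos t)))" (is "?L \<longleftrightarrow> ?R")
proof -
  note e = eig_facts[OF k]
  have P1: "eigP k > 1" using e(3) by simp
  note a = H1_per_frame(1)[OF H] and b = H1_per_frame(2)[OF H] and c = H1_per_component[OF H, of 3]
  let ?I = "integral {- pi..pi}"
  define E where "E = planar (eigP k - eigQ k) (tcoord u) (\<lambda>t. tcoord g t - ncoord u t) (ncoord u) (\<lambda>t. ncoord g t + tcoord u t)
     - (2 - eigQ k) * (?I (\<lambda>t. (tcoord u t)\<^sup>2) + ?I (\<lambda>t. (ncoord u t)\<^sup>2))"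
  define A where "A = (k - min k 3) * ?I (\<lambda>t. (tcoord u t)\<^sup>2)"
  define D where "D = ?I (\<lambda>t. (g t $ 3)\<^sup>2)"
  define C where "C = (k - c2 k) * ?I (\<lambda>t. (u t $ 3)\<^sup>2)"
  \<comment> \<open>k >= min k 3 = P - Q > 2 - Q = c. Strictness is what forces the third component
    to vanish in case of equality.\<close>
  have kc: "k - c2 k > 0" using e(3,6,7) by linarith
  have eq: "energy k u g - c2 k * L2sq u = E + A + D + C"
    unfolding energy_frame[OF H] L2sq_frame[OF H] E_def A_def D_def C_def e(6) e(7) planar_def
    by (simp add: algebra_simps)
  have E0: "E \<ge> 0" using planar_nonneg(1)[OF a b e(1,2) P1 e(4)] by (simp add: E_def)
  have A0: "A \<ge> 0" unfolding A_def
    by (intro mult_nonneg_nonneg integral_nonneg H1p_square_integrable[OF a]) auto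
  have D0: "D \<ge> 0" unfolding D_def
    by (intro integral_nonneg) (use H1p_L2(2)[OF c] in \<open>auto simp: L2_def\<close>)
  have C0: "C \<ge> 0" unfolding C_def using kc
    by (intro mult_nonneg_nonneg integral_nonneg H1p_square_integrable[OF c]) auto
  show ?le using eq E0 A0 D0 C0 by linarith
  have iff: "?L \<longleftrightarrow> E = 0 \<and> A = 0 \<and> D = 0 \<and> C = 0"
    using eq E0 A0 D0 C0 by linarith
  have E_iff: "E = 0 \<longleftrightarrow> (\<exists>p q m. (eigQ k - 1) * m = 0 \<and>
        (\<forall>t\<in>{- pi..pi}. tcoord u t = p * cos t + q * sin t
           \<and> ncoord u t = m + (2 / eigQ k) * (p * sin t - q * cos t)))"
    using planar_equality_iff[OF a b e(1,2) P1 e(4)] by (simp add: E_def)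
  \<comment> \<open>The factor \<open>k - min k 3\<close> is zero up to k = 3; beyond it, A vanishes
    only together with the tangential coordinate, which leaves just the constant mode.\<close>
  have A_iff: "A = 0 \<longleftrightarrow> (k > 3 \<longrightarrow> p = 0 \<and> q = 0)"
    if "\<forall>t\<in>{- pi..pi}. tcoord u t = p * cos t + q * sin t" for p q
  proof -
    have "?I (\<lambda>t. (tcoord u t)\<^sup>2) = pi * (p\<^sup>2 + q\<^sup>2)"
      using wirtinger_defect_trig_zero(3)[OF a, of 0 p q] that by simp
    then show ?thesis by (auto simp: A_def sum_power2_eq_zero_iff)
  qed
  show "?L \<longleftrightarrow> ?R"
  proof
    assume ?L
    then have z: "E = 0" "A = 0" "C = 0" using iff by auto
    have "?I (\<lambda>t. (u t $ 3)\<^sup>2) = 0" using z(3) kc by (simp add: C_def)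
    then have "\<forall>t\<in>{- pi..pi}. u t $ 3 = 0" using H1p_square_zero[OF c] by blast
    moreover obtain p q m where "(eigQ k - 1) * m = 0"
       and "\<forall>t\<in>{- pi..pi}. tcoord u t = p * cos t + q * sin t
           \<and> ncoord u t = m + (2 / eigQ k) * (p * sin t - q * cos t)"
      using z(1) E_iff by blast
    ultimately show ?R using A_iff[of p q] z(2) by blast
  next
    assume R: ?R
    then have u3: "\<forall>t\<in>{- pi..pi}. u t $ 3 = 0" by blast
    \<comment> \<open>The values of the third component fix its derivative only almost everywhere,
      so D = 0 is read off from the vanishing Wirtinger defect.\<close>
    then have "?I (\<lambda>t. (u t $ 3)\<^sup>2) = 0" "wirtinger_defect (\<lambda>t. u t $ 3) (\<lambda>t. g t $ 3) = 0" "mean (\<lambda>t. u t $ 3) = 0"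
      using wirtinger_defect_trig_zero[OF c, of 0 0 0] by auto
    then have "C = 0" "D = 0" by (auto simp: C_def D_def wirtinger_defect_def mean_def)
    moreover have "E = 0" "A = 0" using R E_iff A_iff by blast+
    ultimately show ?L using iff by blast
  qed
qed

section \<open>Amplitude and phase; the normalized equality cases in each range of kappa^2\<close>

lemma polar_amplitude_phase:
  fixes p q :: real
  obtains R \<theta> where "R \<ge> 0" "\<theta> \<in> {- pi..pi}" "p = R * cos \<theta>" "q = - R * sin \<theta>"
proof (cases "p = 0 \<and> q = 0")
  case True
  then show thesis by (intro that[of 0 0]) auto
next
  case False
  define R where "R = sqrt (p\<^sup>2 + q\<^sup>2)"
  have R: "R > 0" "R\<^sup>2 = p\<^sup>2 + q\<^sup>2" using False by (auto simp: R_def sum_power2_gt_zero_iff)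
  \<comment> \<open>The angle is found in [0, 2 pi) and moved to [-pi, pi) by subtracting pi, which
    flips both signs; hence -p here, and q for the required -R sin.\<close>
  have "(- p / R)\<^sup>2 + (q / R)\<^sup>2 = 1"
    using R(1) by (simp add: power_divide R(2)[symmetric] flip: add_divide_distrib)
  then obtain t where t: "0 \<le> t" "t < 2 * pi" "- p / R = cos t" "q / R = sin t"
    by (rule sincos_total_2pi)
  show thesis
    by (rule that[of R "t - pi"]) (use t R(1) in \<open>auto simp: cos_diff sin_diff field_simps\<close>)
qed

text \<open>Common source of the three cases. The unknowns are the amplitude \<open>R\<close> of the
  first mode and the mean \<open>m\<close>, tied by the normalization: \<open>eigQ k > 1\<close>
  kills m, \<open>k > 3\<close> kills R, and at k = 3 both survive.\<close>

lemma equality_iff_normalized: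
  assumes k: "k > 0" and H: "H1_per u g" and n: "L2sq u = 2 * pi"
  shows "energy k u g = c2 k * L2sq u \<longleftrightarrow>
      (\<forall>t\<in>{- pi..pi}. u t $ 3 = 0) \<and>
      (\<exists>\<theta>\<in>{- pi..pi}. \<exists>R\<ge>0. \<exists>m. (eigQ k - 1) * m = 0 \<and> (k > 3 \<longrightarrow> R = 0) \<and>
        R\<^sup>2 * (1 + (2 / eigQ k)\<^sup>2) / 2 + m\<^sup>2 = 1 \<and>
        (\<forall>t\<in>{- pi..pi}. u t = (R * cos (\<theta> + t)) *\<^sub>R tauvec t
           + (m + 2 / eigQ k * R * sin (\<theta> + t)) *\<^sub>R nvec t))" (is "?L \<longleftrightarrow> ?R")
proof
  let ?s = "2 / eigQ k"
  assume ?L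
  then obtain p q m where u3: "\<forall>t\<in>{- pi..pi}. u t $ 3 = 0" and m: "(eigQ k - 1) * m = 0"
    and pq: "k > 3 \<longrightarrow> p = 0 \<and> q = 0"
    and ab: "\<forall>t\<in>{- pi..pi}. tcoord u t = p * cos t + q * sin t \<and> ncoord u t = m + ?s * (p * sin t - q * cos t)"
    using energy_c2_bound(2)[OF k H] by blast
  obtain R \<theta> where R: "R \<ge> 0" "\<theta> \<in> {- pi..pi}" "p = R * cos \<theta>" "q = - R * sin \<theta>"
    by (rule polar_amplitude_phase)
  have R2: "p\<^sup>2 + q\<^sup>2 = R\<^sup>2"
    using sin_cos_squared_add[of \<theta>] unfolding R(3,4) by algebra
  have "integral {- pi..pi} (\<lambda>t. (tcoord u t)\<^sup>2) = 2 * pi * 0\<^sup>2 + pi * (p\<^sup>2 + q\<^sup>2)"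
    by (rule wirtinger_defect_trig_zero(3)[OF H1_per_frame(1)[OF H]]) (use ab in auto)
  moreover have "integral {- pi..pi} (\<lambda>t. (ncoord u t)\<^sup>2) = 2 * pi * m\<^sup>2 + pi * ((- ?s * q)\<^sup>2 + (?s * p)\<^sup>2)"
    by (rule wirtinger_defect_trig_zero(3)[OF H1_per_frame(2)[OF H]]) (use ab in \<open>auto simp: algebra_simps\<close>)
  moreover have "integral {- pi..pi} (\<lambda>t. (u t $ 3)\<^sup>2) = 2 * pi * 0\<^sup>2 + pi * (0\<^sup>2 + 0\<^sup>2)"
    by (rule wirtinger_defect_trig_zero(3)[OF H1_per_component[OF H]]) (use u3 in auto)
  ultimately have "2 * pi = pi * (p\<^sup>2 + q\<^sup>2) + (2 * pi * m\<^sup>2 + pi * ((- ?s * q)\<^sup>2 + (?s * p)\<^sup>2))"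
    using L2sq_frame[OF H] n by simp
  also have "\<dots> = pi * (R\<^sup>2 + 2 * m\<^sup>2 + ?s\<^sup>2 * R\<^sup>2)"
    unfolding R2[symmetric] by (simp only: power_mult_distrib power2_minus) (simp add: algebra_simps)
  finally have "2 = R\<^sup>2 + 2 * m\<^sup>2 + ?s\<^sup>2 * R\<^sup>2"
    by (simp only: mult.commute[of 2 pi] mult_cancel_left pi_neq_zero simp_thms)
  moreover have "(x + z) / 2 + y = 1" if "2 = x + 2 * y + z" for x y z :: real
    using that by (simp add: field_simps)
  ultimately have norm: "R\<^sup>2 * (1 + ?s\<^sup>2) / 2 + m\<^sup>2 = 1"
    unfolding distrib_left mult_1_right mult.commute[of "R\<^sup>2" "?s\<^sup>2"] by blast
  have R0: "k > 3 \<longrightarrow> R = 0" using pq R2 by auto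
  have "u t = (R * cos (\<theta> + t)) *\<^sub>R tauvec t + (m + ?s * R * sin (\<theta> + t)) *\<^sub>R nvec t" if t: "t \<in> {- pi..pi}" for t
  proof -
    have "tcoord u t = R * cos (\<theta> + t)" "ncoord u t = m + ?s * R * sin (\<theta> + t)"
      using bspec[OF ab t] by (simp_all add: R(3,4) cos_add sin_add algebra_simps)
    then show ?thesis unfolding vec3_frame using u3 t by (simp add: tcoord_def ncoord_def)
  qed
  then show ?R using u3 R(1,2) R0 m norm by blast
next
  let ?s = "2 / eigQ k"
  assume ?R
  then obtain \<theta> R m where u3: "\<forall>t\<in>{- pi..pi}. u t $ 3 = 0" and m: "(eigQ k - 1) * m = 0"
    and R0: "k > 3 \<longrightarrow> R = 0"
    and u: "\<And>t. t \<in> {- pi..pi} \<Longrightarrow> u t = (R * cos (\<theta> + t)) *\<^sub>R tauvec t + (m + ?s * R * sin (\<theta> + t)) *\<^sub>R nvec t"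
    by blast
  have "tcoord u t = (R * cos \<theta>) * cos t + (- R * sin \<theta>) * sin t \<and>
     ncoord u t = m + ?s * ((R * cos \<theta>) * sin t - (- R * sin \<theta>) * cos t)" if t: "t \<in> {- pi..pi}" for t
    using u[OF t] unfolding vec3_frame tcoord_def[symmetric] ncoord_def[symmetric]
    by (simp add: cos_add sin_add algebra_simps)
  then show ?L using energy_c2_bound(2)[OF k H] u3 m R0
    by (metis (no_types, lifting) mult_zero_left neg_equal_0_iff_equal)
qed

text \<open>P = Q + k and P Q = 4 give 1 - (Q/2)^2 = k Q / 4, so by the double angle formula twice
  arctan (Q/2) has tangent 4 / k. Thus tan phi = Q / 2 is the ratio of the tangential to the normal
  amplitude.\<close>

lemma phik_eq_arctan:
  assumes "0 < k" "k < 3"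
  shows "phik k = arctan (eigQ k / 2)"
proof -
  note e = eig_facts[OF assms(1)]
  define Q where "Q = eigQ k"
  have Q: "1 < Q" "Q < 2" using e assms by (auto simp: Q_def)
  have PQ: "eigP k = Q + k" using e(6) assms by (simp add: Q_def)
  have "4 - Q\<^sup>2 = Q * k" using e(1) unfolding PQ Q_def[symmetric] by (simp add: power2_eq_square algebra_simps)
  then have e: "1 - (Q / 2)\<^sup>2 = Q * k / 4" by (simp add: power_divide field_simps)
  have "2 * (Q / 2) / (1 - (Q / 2)\<^sup>2) = 4 / k" unfolding e using Q assms by simp
  then have "2 * arctan (Q / 2) = arctan (4 / k)"
    using arctan_double[of "Q / 2"] Q by simp
  then show ?thesis by (simp add: phik_def Q_def)
qed

text \<open>With m = 0 the normalization fixes R; since 2 / Q is the cotangent of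
  \<open>phik k\<close>, the two amplitudes become sqrt 2 times the sine and the cosine of that
  angle.\<close>

lemma equality_small_k:
  assumes k: "0 < k" "k < 3" and H: "H1_per u g" and n: "L2sq u = 2 * pi"
  shows "energy k u g = c2 k * L2sq u \<longleftrightarrow>
      (\<forall>t\<in>{- pi..pi}. u t $ 3 = 0) \<and>
      (\<exists>\<theta>\<in>{- pi..pi}. \<forall>t\<in>{- pi..pi}. u t =
          (sqrt 2 * sin (phik k) * cos (\<theta> + t)) *\<^sub>R tauvec t
          + (sqrt 2 * cos (phik k) * sin (\<theta> + t)) *\<^sub>R nvec t)"
proof -
  define Q where "Q = eigQ k"
  have Q: "1 < Q" "Q < 2" using eig_facts[OF k(1)] k by (auto simp: Q_def)
  have c: "cos (phik k) = 1 / sqrt (1 + (Q / 2)\<^sup>2)" and s: "sin (phik k) = (Q / 2) / sqrt (1 + (Q / 2)\<^sup>2)"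
    using phik_eq_arctan[OF k] by (simp_all add: cos_arctan sin_arctan Q_def)
  have sc: "sin (phik k) = (Q / 2) * cos (phik k)" "cos (phik k) = 2 / Q * sin (phik k)" "sin (phik k) > 0"
    unfolding c s using Q by (auto intro!: divide_pos_pos simp: add_pos_nonneg)
  have amp: "R\<^sup>2 * (1 + (2 / Q)\<^sup>2) / 2 + 0\<^sup>2 = 1 \<longleftrightarrow> R = sqrt 2 * sin (phik k)" if "R \<ge> 0" for R
  proof -
    have "(sin (phik k))\<^sup>2 * (1 + (2 / Q)\<^sup>2) = (sin (phik k))\<^sup>2 + (2 / Q * sin (phik k))\<^sup>2"
      by (simp only: power_mult_distrib) (simp add: algebra_simps)
    also have "\<dots> = 1" unfolding sc(2)[symmetric] by simp
    finally have one: "(sin (phik k))\<^sup>2 * (1 + (2 / Q)\<^sup>2) = 1" .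
    have pos: "1 + (2 / Q)\<^sup>2 > 0" by (simp add: add_pos_nonneg)
    have "R\<^sup>2 * (1 + (2 / Q)\<^sup>2) / 2 + 0\<^sup>2 = 1 \<longleftrightarrow>
        R\<^sup>2 * (1 + (2 / Q)\<^sup>2) = (2 * (sin (phik k))\<^sup>2) * (1 + (2 / Q)\<^sup>2)"
      using one by (simp only: mult.assoc) auto
    also have "\<dots> \<longleftrightarrow> R\<^sup>2 = 2 * (sin (phik k))\<^sup>2"
      using pos by (simp only: mult_cancel_right) auto
    also have "\<dots> \<longleftrightarrow> R\<^sup>2 = (sqrt 2 * sin (phik k))\<^sup>2" by (simp add: power_mult_distrib)
    also have "\<dots> \<longleftrightarrow> R = sqrt 2 * sin (phik k)"
      using that sc(3) by (intro power2_eq_iff_nonneg) auto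
    finally show ?thesis .
  qed
  have m0: "(Q - 1) * m = 0 \<longleftrightarrow> m = 0" for m using Q by simp
  have form: "2 / Q * (sqrt 2 * sin (phik k)) * x = sqrt 2 * cos (phik k) * x" for x
    using sc(2) by simp
  have R0: "sqrt 2 * sin (phik k) \<ge> 0" using sc(3) by simp
  show ?thesis
    unfolding equality_iff_normalized[OF k(1) H n] Q_def[symmetric] m0
  proof (intro conj_cong refl bex_cong iffI)
    fix \<theta>
    assume "\<exists>R\<ge>0. \<exists>m. m = 0 \<and> (3 < k \<longrightarrow> R = 0) \<and> R\<^sup>2 * (1 + (2 / Q)\<^sup>2) / 2 + m\<^sup>2 = 1 \<and>
        (\<forall>t\<in>{- pi..pi}. u t = (R * cos (\<theta> + t)) *\<^sub>R tauvec t + (m + 2 / Q * R * sin (\<theta> + t)) *\<^sub>R nvec t)"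
    then obtain R where R: "R \<ge> 0" "R\<^sup>2 * (1 + (2 / Q)\<^sup>2) / 2 + 0\<^sup>2 = 1" and
      u: "\<forall>t\<in>{- pi..pi}. u t = (R * cos (\<theta> + t)) *\<^sub>R tauvec t + (0 + 2 / Q * R * sin (\<theta> + t)) *\<^sub>R nvec t"
      by blast
    have "R = sqrt 2 * sin (phik k)" using amp[OF R(1)] R(2) by (rule iffD1)
    with u have "\<forall>t\<in>{- pi..pi}. u t = (sqrt 2 * sin (phik k) * cos (\<theta> + t)) *\<^sub>R tauvec t
        + (0 + 2 / Q * (sqrt 2 * sin (phik k)) * sin (\<theta> + t)) *\<^sub>R nvec t"
      by (simp only:)
    then show "\<forall>t\<in>{- pi..pi}. u t = (sqrt 2 * sin (phik k) * cos (\<theta> + t)) *\<^sub>R tauvec t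
          + (sqrt 2 * cos (phik k) * sin (\<theta> + t)) *\<^sub>R nvec t"
      unfolding form by simp
  next
    fix \<theta>
    assume A: "\<forall>t\<in>{- pi..pi}. u t = (sqrt 2 * sin (phik k) * cos (\<theta> + t)) *\<^sub>R tauvec t
          + (sqrt 2 * cos (phik k) * sin (\<theta> + t)) *\<^sub>R nvec t"
    show "\<exists>R\<ge>0. \<exists>m. m = 0 \<and> (3 < k \<longrightarrow> R = 0) \<and> R\<^sup>2 * (1 + (2 / Q)\<^sup>2) / 2 + m\<^sup>2 = 1 \<and>
        (\<forall>t\<in>{- pi..pi}. u t = (R * cos (\<theta> + t)) *\<^sub>R tauvec t + (m + 2 / Q * R * sin (\<theta> + t)) *\<^sub>R nvec t)"
    proof (rule exI[of _ "sqrt 2 * sin (phik k)"], intro conjI exI[of _ 0])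
      show "(sqrt 2 * sin (phik k))\<^sup>2 * (1 + (2 / Q)\<^sup>2) / 2 + 0\<^sup>2 = 1" using amp[OF R0] by blast
      show "\<forall>t\<in>{- pi..pi}. u t = (sqrt 2 * sin (phik k) * cos (\<theta> + t)) *\<^sub>R tauvec t
        + (0 + 2 / Q * (sqrt 2 * sin (phik k)) * sin (\<theta> + t)) *\<^sub>R nvec t"
        using A unfolding form by simp
    qed (use R0 k in auto)
  qed
qed

lemma equality_k_3:
  assumes H: "H1_per u g" and n: "L2sq u = 2 * pi"
  shows "energy 3 u g = c2 3 * L2sq u \<longleftrightarrow>
      (\<forall>t\<in>{- pi..pi}. u t $ 3 = 0) \<and>
      (\<exists>\<theta>\<in>{- pi..pi}. \<exists>\<rho>\<in>{0..1 / sqrt 5}. \<exists>s\<in>{1, -1::real}.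
         \<forall>t\<in>{- pi..pi}. u t =
           (sqrt 2 * \<rho> * cos (\<theta> + t)) *\<^sub>R tauvec t
           + (s * sqrt (1 - 5 * \<rho>\<^sup>2) + 2 * sqrt 2 * \<rho> * sin (\<theta> + t)) *\<^sub>R nvec t)"
proof -
  have Q: "eigQ 3 = 1" by (rule eig_facts(8)) auto
  have five: "1 - 5 * \<rho>\<^sup>2 \<ge> 0 \<longleftrightarrow> \<rho> \<le> 1 / sqrt 5" if "\<rho> \<ge> 0" for \<rho> :: real
  proof -
    have "\<rho> \<le> 1 / sqrt 5 \<longleftrightarrow> \<rho>\<^sup>2 \<le> (1 / sqrt 5)\<^sup>2"
      using that by (subst abs_le_square_iff[symmetric]) auto
    then show ?thesis by (auto simp: power_divide)
  qed
  show ?thesis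
    unfolding equality_iff_normalized[OF zero_less_numeral H n] Q
  proof (intro conj_cong refl bex_cong iffI)
    fix \<theta>
    assume "\<exists>R\<ge>0. \<exists>m. (1 - 1) * m = 0 \<and> ((3::real) < 3 \<longrightarrow> R = 0) \<and> R\<^sup>2 * (1 + (2 / 1)\<^sup>2) / 2 + m\<^sup>2 = 1 \<and>
        (\<forall>t\<in>{- pi..pi}. u t = (R * cos (\<theta> + t)) *\<^sub>R tauvec t + (m + 2 / 1 * R * sin (\<theta> + t)) *\<^sub>R nvec t)"
    then obtain R m where R: "R \<ge> 0" "R\<^sup>2 * 5 / 2 + m\<^sup>2 = 1" and
      u: "\<forall>t\<in>{- pi..pi}. u t = (R * cos (\<theta> + t)) *\<^sub>R tauvec t + (m + 2 * R * sin (\<theta> + t)) *\<^sub>R nvec t"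
      by auto
    \<comment> \<open>In this scale the normalization reads m^2 = 1 - 5 rho^2, so the range of rho
      only expresses that m^2 is nonnegative.\<close>
    define \<rho> where "\<rho> = R / sqrt 2"
    have r: "\<rho> \<ge> 0" "R = sqrt 2 * \<rho>" "m\<^sup>2 = 1 - 5 * \<rho>\<^sup>2"
      using R by (auto simp: \<rho>_def power_divide)
    then have r5: "\<rho> \<in> {0..1 / sqrt 5}" using five[OF r(1)] zero_le_power2[of m] by simp
    \<comment> \<open>The sign assigned to m = 0 is arbitrary, as the square root is then
      zero.\<close>
    define s :: real where "s = (if m \<ge> 0 then 1 else - 1)"
    have s: "s \<in> {1, -1}" "m = s * sqrt (1 - 5 * \<rho>\<^sup>2)"
      unfolding r(3)[symmetric] by (auto simp: s_def)
    have "\<forall>t\<in>{- pi..pi}. u t = (sqrt 2 * \<rho> * cos (\<theta> + t)) *\<^sub>R tauvec t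
           + (s * sqrt (1 - 5 * \<rho>\<^sup>2) + 2 * sqrt 2 * \<rho> * sin (\<theta> + t)) *\<^sub>R nvec t"
      using u unfolding s(2)[symmetric] r(2) by (simp add: mult.assoc)
    then show "\<exists>\<rho>\<in>{0..1 / sqrt 5}. \<exists>s\<in>{1, -1::real}.
         \<forall>t\<in>{- pi..pi}. u t = (sqrt 2 * \<rho> * cos (\<theta> + t)) *\<^sub>R tauvec t
           + (s * sqrt (1 - 5 * \<rho>\<^sup>2) + 2 * sqrt 2 * \<rho> * sin (\<theta> + t)) *\<^sub>R nvec t"
      using r5 s(1) by blast
  next
    fix \<theta>
    assume "\<exists>\<rho>\<in>{0..1 / sqrt 5}. \<exists>s\<in>{1, -1::real}.
         \<forall>t\<in>{- pi..pi}. u t = (sqrt 2 * \<rho> * cos (\<theta> + t)) *\<^sub>R tauvec t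
           + (s * sqrt (1 - 5 * \<rho>\<^sup>2) + 2 * sqrt 2 * \<rho> * sin (\<theta> + t)) *\<^sub>R nvec t"
    then obtain \<rho> s where rs: "\<rho> \<in> {0..1 / sqrt 5}" "s \<in> {1, -1::real}" and
      u: "\<forall>t\<in>{- pi..pi}. u t = (sqrt 2 * \<rho> * cos (\<theta> + t)) *\<^sub>R tauvec t
           + (s * sqrt (1 - 5 * \<rho>\<^sup>2) + 2 * sqrt 2 * \<rho> * sin (\<theta> + t)) *\<^sub>R nvec t"
      by blast
    have r: "\<rho> \<ge> 0" "\<rho> \<le> 1 / sqrt 5" and s: "s = 1 \<or> s = -1" using rs by auto
    have "(s * sqrt (1 - 5 * \<rho>\<^sup>2))\<^sup>2 = 1 - 5 * \<rho>\<^sup>2"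
      using s five[OF r(1)] r(2) by (auto simp: power_mult_distrib)
    moreover have "(sqrt 2 * \<rho>)\<^sup>2 = 2 * \<rho>\<^sup>2" by (simp add: power_mult_distrib)
    ultimately have "(sqrt 2 * \<rho>)\<^sup>2 * (1 + (2 / 1)\<^sup>2) / 2 + (s * sqrt (1 - 5 * \<rho>\<^sup>2))\<^sup>2 = 1"
      by simp
    then show "\<exists>R\<ge>0. \<exists>m. (1 - 1) * m = 0 \<and> ((3::real) < 3 \<longrightarrow> R = 0) \<and> R\<^sup>2 * (1 + (2 / 1)\<^sup>2) / 2 + m\<^sup>2 = 1 \<and>
        (\<forall>t\<in>{- pi..pi}. u t = (R * cos (\<theta> + t)) *\<^sub>R tauvec t + (m + 2 / 1 * R * sin (\<theta> + t)) *\<^sub>R nvec t)"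
      using r(1) u by (intro exI[of _ "sqrt 2 * \<rho>"] conjI exI[of _ "s * sqrt (1 - 5 * \<rho>\<^sup>2)"])
        (simp_all add: mult.assoc)
  qed
qed

lemma equality_large_k:
  assumes k: "k > 3" and H: "H1_per u g" and n: "L2sq u = 2 * pi"
  shows "energy k u g = c2 k * L2sq u \<longleftrightarrow>
      (\<forall>t\<in>{- pi..pi}. u t $ 3 = 0) \<and>
      ((\<forall>t\<in>{- pi..pi}. u t = nvec t) \<or> (\<forall>t\<in>{- pi..pi}. u t = - nvec t))"
proof -
  have k0: "k > 0" using k by simp
  have Q: "eigQ k = 1" using eig_facts(8)[OF k0] k by simp
  show ?thesis
    unfolding equality_iff_normalized[OF k0 H n] Q
  proof (intro conj_cong refl iffI)
    assume "\<exists>\<theta>\<in>{- pi..pi}. \<exists>R\<ge>0. \<exists>m. (1 - 1) * m = 0 \<and> (3 < k \<longrightarrow> R = 0) \<and> R\<^sup>2 * (1 + (2 / 1)\<^sup>2) / 2 + m\<^sup>2 = 1 \<and>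
        (\<forall>t\<in>{- pi..pi}. u t = (R * cos (\<theta> + t)) *\<^sub>R tauvec t + (m + 2 / 1 * R * sin (\<theta> + t)) *\<^sub>R nvec t)"
    then obtain m where "m\<^sup>2 = 1" "\<forall>t\<in>{- pi..pi}. u t = m *\<^sub>R nvec t"
      using k by auto
    then show "(\<forall>t\<in>{- pi..pi}. u t = nvec t) \<or> (\<forall>t\<in>{- pi..pi}. u t = - nvec t)"
      by (auto simp: power2_eq_1_iff)
  next
    assume "(\<forall>t\<in>{- pi..pi}. u t = nvec t) \<or> (\<forall>t\<in>{- pi..pi}. u t = - nvec t)"
    then obtain m :: real where "m\<^sup>2 = 1" "\<forall>t\<in>{- pi..pi}. u t = m *\<^sub>R nvec t"
      by (metis power_one power2_minus scaleR_minus1_left scaleR_one)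
    then show "\<exists>\<theta>\<in>{- pi..pi}. \<exists>R\<ge>0. \<exists>m. (1 - 1) * m = 0 \<and> (3 < k \<longrightarrow> R = 0) \<and> R\<^sup>2 * (1 + (2 / 1)\<^sup>2) / 2 + m\<^sup>2 = 1 \<and>
        (\<forall>t\<in>{- pi..pi}. u t = (R * cos (\<theta> + t)) *\<^sub>R tauvec t + (m + 2 / 1 * R * sin (\<theta> + t)) *\<^sub>R nvec t)"
      by (intro bexI[of _ 0] exI[of _ 0] conjI exI[of _ m]) auto
  qed
qed

text \<open>Unit length implies the normalization, so the classification applies. In the frame a
  minimizer runs along an ellipse with axes R and s R, where s = 2 / Q > 1, and hence its length
  cannot be constant.\<close>

lemma no_unit_minimizer:
  assumes k: "0 < k" "k < 3" and H: "H1_per u g"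
    and unit: "AE t in lebesgue_on {- pi..pi}. norm (u t) = 1"
  shows "energy k u g \<noteq> c2 k * L2sq u"
proof
  assume E: "energy k u g = c2 k * L2sq u"
  have "AE t in lebesgue. t \<in> {- pi..pi} \<longrightarrow> norm (u t) = 1"
    using unit by (simp add: AE_restrict_space_iff)
  then obtain N where "N \<in> null_sets lebesgue" "{t. \<not> (t \<in> {- pi..pi} \<longrightarrow> norm (u t) = 1)} \<subseteq> N"
    by (auto simp: eventually_ae_filter)
  then have N: "negligible N" "\<And>t. t \<in> {- pi..pi} - N \<Longrightarrow> norm (u t) = 1"
    by (auto simp: negligible_iff_null_sets)
  have "L2sq u = integral {- pi..pi} (\<lambda>t. 1)"
    unfolding L2sq_def by (rule integral_spike[OF N(1)]) (simp add: N(2))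
  then have n: "L2sq u = 2 * pi" by simp
  obtain \<theta> R m where R: "R\<^sup>2 * (1 + (2 / eigQ k)\<^sup>2) / 2 + m\<^sup>2 = 1" and m: "(eigQ k - 1) * m = 0"
    and u: "\<And>t. t \<in> {- pi..pi} \<Longrightarrow> u t = (R * cos (\<theta> + t)) *\<^sub>R tauvec t
           + (m + 2 / eigQ k * R * sin (\<theta> + t)) *\<^sub>R nvec t"
    using E equality_iff_normalized[OF k(1) H n] by blast
  define s where "s = 2 / eigQ k"
  have Q: "1 < eigQ k" "eigQ k < 2" using eig_facts[OF k(1)] k by auto
  have s: "s > 1" using Q by (simp add: s_def)
  have m0: "m = 0" using m Q by simp
  \<comment> \<open>The closed formula is continuous, so its vanishing almost everywhere on the
    interval becomes vanishing everywhere there.\<close>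
  define f where "f = (\<lambda>t. R\<^sup>2 * ((cos (\<theta> + t))\<^sup>2 + s\<^sup>2 * (sin (\<theta> + t))\<^sup>2) - 1)"
  have fu: "f t = (norm (u t))\<^sup>2 - 1" if t: "t \<in> {- pi..pi}" for t
  proof -
    have "u t $ 3 = 0 \<and> tcoord u t = R * cos (\<theta> + t) \<and> ncoord u t = s * R * sin (\<theta> + t)"
      using u[OF t] m0 unfolding vec3_frame tcoord_def[symmetric] ncoord_def[symmetric] s_def by simp
    then show ?thesis unfolding norm_frame f_def by (simp add: power_mult_distrib algebra_simps)
  qed
  have "integral {- pi..pi} (\<lambda>t. (f t)\<^sup>2) = integral {- pi..pi} (\<lambda>t. 0)"
    by (rule integral_spike[OF N(1)]) (simp add: fu N(2))
  moreover have "continuous_on {- pi..pi} (\<lambda>t. (f t)\<^sup>2)"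
    unfolding f_def by (intro continuous_intros)
  ultimately have f0: "f t = 0" if "t \<in> {- pi..pi}" for t
    using integral_eq_0_iff[of "- pi" pi "\<lambda>t. (f t)\<^sup>2"] that by simp
  have R0: "R\<^sup>2 * (s\<^sup>2 - 1) \<noteq> 0"
    using R m0 s by (auto simp: power2_eq_1_iff)
  \<comment> \<open>A quarter turn exchanges the axes of the ellipse. The resulting equation cos (2
    (theta + t)) = 0, taken at t = 0 and t = pi / 4, would make both the cosine and the sine of 2
    theta vanish.\<close>
  have diff: "f t - f (t + pi / 2) = - (R\<^sup>2 * (s\<^sup>2 - 1)) * cos (2 * (\<theta> + t))" for t
  proof -
    have "cos (\<theta> + (t + pi / 2)) = - sin (\<theta> + t)" "sin (\<theta> + (t + pi / 2)) = cos (\<theta> + t)"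
      by (simp_all add: cos_add sin_add flip: add.assoc)
    then show ?thesis unfolding f_def cos_double by (simp add: algebra_simps)
  qed
  have "cos (2 * (\<theta> + t)) = 0" if "0 \<le> t" "t \<le> pi / 2" for t
  proof -
    have "t \<in> {- pi..pi}" "t + pi / 2 \<in> {- pi..pi}"
      unfolding atLeastAtMost_iff using that pi_gt_zero by linarith+
    then show ?thesis using diff[of t] f0 R0 by simp
  qed
  from this[of 0] this[of "pi / 4"] have "cos (2 * \<theta>) = 0" "cos (2 * \<theta> + pi / 2) = 0"
    by (simp_all add: algebra_simps)
  then show False
    using sin_cos_squared_add[of "2 * \<theta>"] by (simp add: cos_add)
qed

text \<open>Sharpness of \<open>c2 k2\<close> is contained in the equality cases: the listed
  functions are smooth, periodic and normalized, so equality is attained for every k2. The cases are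
  stated pointwise on the interval because \<open>u\<close> is the continuous
  representative.\<close>

theorem mainTheorem3:
  fixes k2 :: real
  assumes "k2 > 0"
  shows
    "(\<forall>u g. H1_per u g \<longrightarrow> energy k2 u g \<ge> c2 k2 * L2sq u)
     \<and>
     (\<forall>u g. H1_per u g \<and> L2sq u / (2 * pi) = 1 \<longrightarrow>
        (energy k2 u g = c2 k2 * L2sq u \<longleftrightarrow>
           (\<forall>t\<in>{-pi..pi}. u t $ 3 = 0) \<and>
           (k2 > 3 \<longrightarrow> (\<forall>t\<in>{-pi..pi}. u t = nvec t) \<or> (\<forall>t\<in>{-pi..pi}. u t = - nvec t)) \<and>
           (k2 = 3 \<longrightarrow>
              (\<exists>\<theta>\<in>{-pi..pi}. \<exists>\<rho>\<in>{0..1 / sqrt 5}. \<exists>s\<in>{1, -1::real}.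
                 \<forall>t\<in>{-pi..pi}. u t =
                   (sqrt 2 * \<rho> * cos (\<theta> + t)) *\<^sub>R tauvec t
                   + (s * sqrt (1 - 5 * \<rho>\<^sup>2) + 2 * sqrt 2 * \<rho> * sin (\<theta> + t)) *\<^sub>R nvec t)) \<and>
           (k2 < 3 \<longrightarrow>
              (\<exists>\<theta>\<in>{-pi..pi}.
                 \<forall>t\<in>{-pi..pi}. u t =
                   (sqrt 2 * sin (phik k2) * cos (\<theta> + t)) *\<^sub>R tauvec t
                   + (sqrt 2 * cos (phik k2) * sin (\<theta> + t)) *\<^sub>R nvec t))))
     \<and>
     (k2 < 3 \<longrightarrow>
        \<not> (\<exists>u g. H1_per u g \<and> (AE t in lebesgue_on {-pi..pi}. norm (u t) = 1)
                 \<and> energy k2 u g = c2 k2 * L2sq u))"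
  (is "?A \<and> ?B \<and> ?C")
proof (intro conjI)
  show ?A using energy_c2_bound(1)[OF assms] by blast
  show ?C using no_unit_minimizer[OF assms] by blast
  show ?B
  proof (intro allI impI, elim conjE)
    fix u g
    assume H: "H1_per u g" and "L2sq u / (2 * pi) = 1"
    then have n: "L2sq u = 2 * pi" by simp
    consider "k2 > 3" | "k2 = 3" | "k2 < 3" by linarith
    then show "energy k2 u g = c2 k2 * L2sq u \<longleftrightarrow>
           (\<forall>t\<in>{-pi..pi}. u t $ 3 = 0) \<and>
           (k2 > 3 \<longrightarrow> (\<forall>t\<in>{-pi..pi}. u t = nvec t) \<or> (\<forall>t\<in>{-pi..pi}. u t = - nvec t)) \<and>
           (k2 = 3 \<longrightarrow>
              (\<exists>\<theta>\<in>{-pi..pi}. \<exists>\<rho>\<in>{0..1 / sqrt 5}. \<exists>s\<in>{1, -1::real}.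
                 \<forall>t\<in>{-pi..pi}. u t =
                   (sqrt 2 * \<rho> * cos (\<theta> + t)) *\<^sub>R tauvec t
                   + (s * sqrt (1 - 5 * \<rho>\<^sup>2) + 2 * sqrt 2 * \<rho> * sin (\<theta> + t)) *\<^sub>R nvec t)) \<and>
           (k2 < 3 \<longrightarrow>
              (\<exists>\<theta>\<in>{-pi..pi}.
                 \<forall>t\<in>{-pi..pi}. u t =
                   (sqrt 2 * sin (phik k2) * cos (\<theta> + t)) *\<^sub>R tauvec t
                   + (sqrt 2 * cos (phik k2) * sin (\<theta> + t)) *\<^sub>R nvec t))"
    proof cases
      case 1
      then show ?thesis using equality_large_k[OF 1 H n] by simp
    next
      case 2
      then show ?thesis using equality_k_3[OF H n] by simp
    next
      case 3
      then show ?thesis using equality_small_k[OF assms 3 H n] by simp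
    qed
  qed
qed

end
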